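(* Suppose $E:\mathcal{P}_{2,\omega_0}(\mathbb{R}^d)\to\mathbb{R}\cup\{+\infty\}$ is proper, coercive, lower semicontinuous and $\lambda$-convex along generalized geodesics for some $\lambda\in\mathbb{R}$. Let $\mu\in D(|\partial E|)$ and $0<h_i\le\tau<\frac1{\lambda^-}$ for $i\ge1$. Writing $J^m=J_{h_m}\circ\cdots\circ J_{h_1}\mu$ ($J^0=\mu$), $J^n=J^n_\tau\mu$, $S_m=\sum_{k=1}^mh_k$, $P_m=\prod_{k=1}^m(1-\lambda^-h_k)^{-1}$, we have for all $n,m\ge0$ $$W_2^2(J^n,J^m)\le\big[(n\tau-S_m)^2+\tau S_m+2\tau^2n\big](1-\lambda^-\tau)^{-2n}P_m^2|\partial E|^2(\mu).$$
   Context: Fix a probability measure $\omega_0$ on $\mathbb{R}^d$. $W_2$ is the quadratic Wasserstein distance, $\Gamma_0$ the optimal couplings; $\mathcal{P}_{2,\omega_0}(\mathbb{R}^d)=\{\mu:W_2(\mu,\omega_0)<\infty\}$. A transport plan from $\mu_0$ to $\mu_1$ with base $\omega$ is $\boldsymbol\omega\in\mathcal{P}((\mathbb{R}^d)^3)$ with $\pi^{1,2}\#\boldsymbol\omega\in\Gamma_0(\omega,\mu_0)$, $\pi^{1,3}\#\boldsymbol\omega\in\Gamma_0(\omega,\mu_1)$; generalized geodesic $\mu_\alpha=((1-\alpha)\pi^2+\alpha\pi^3)\#\boldsymbol\omega$; $W_{2,\boldsymbol\omega}(\mu_0,\mu_1)=(\int|x_2-x_3|^2d\boldsymbol\omega)^{1/2}$.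 $D(E)=\{E<\infty\}$; proper: $D(E)\ne\emptyset$; coercive: $\exists\tau_0>0,u_0$ with $\inf_v\{\frac1{2\tau_0}W_2^2(u_0,v)+E(v)\}>-\infty$; lower semicontinuous w.r.t. $W_2$; $\lambda$-convex along generalized geodesics: for all $\mu_0,\mu_1,\omega$ there is a generalized geodesic from $\mu_0$ to $\mu_1$ with base $\omega$ (induced by some $\boldsymbol\omega$) with $E(\mu_\alpha)\le(1-\alpha)E(\mu_0)+\alpha E(\mu_1)-\alpha(1-\alpha)\frac\lambda2W^2_{2,\boldsymbol\omega}(\mu_0,\mu_1)$. $\lambda^-=\max\{0,-\lambda\}$, $1/\lambda^-=+\infty$ if $\lambda^-=0$. $J_\tau\mu=\operatorname{argmin}_\nu\{\frac1{2\tau}W_2^2(\mu,\nu)+E(\nu)\}$, $J^n_\tau$ its $n$-fold iterate. Metric slope $|\partial E|(\mu)=\limsup_{\nu\to\mu}(E(\mu)-E(\nu))^+/W_2(\mu,\nu)$; $D(|\partial E|)=\{\mu\in D(E):|\partial E|(\mu)<\infty\}$. *)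

theory Defs
  imports "HOL-Probability.Probability"
begin

text \<open>Points of R^d are elements of a Euclidean space 'a (dimension DIM('a) = d).
 Probability measures on R^d: probability measures with the Borel sigma-algebra.\<close>

definition Prob :: "'a::euclidean_space measure set" where
  "Prob = {\<mu>. prob_space \<mu> \<and> sets \<mu> = sets borel}"

definition couplings :: "'a::euclidean_space measure \<Rightarrow> 'a measure \<Rightarrow> ('a \<times> 'a) measure set" where
  "couplings \<mu> \<nu> = {\<gamma>. prob_space \<gamma> \<and> sets \<gamma> = sets borel \<and>
      distr \<gamma> borel fst = \<mu> \<and> distr \<gamma> borel snd = \<nu>}"

definition cost :: "('a::euclidean_space \<times> 'a) measure \<Rightarrow> ennreal" where
  "cost \<gamma> = (\<integral>\<^sup>+ p. ennreal ((dist (fst p) (snd p))\<^sup>2) \<partial>\<gamma>)"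

definition W2sq :: "'a::euclidean_space measure \<Rightarrow> 'a measure \<Rightarrow> ennreal" where
  "W2sq \<mu> \<nu> = (INF \<gamma>\<in>couplings \<mu> \<nu>. cost \<gamma>)"

text \<open>W2 as a real number; only used where W2sq is finite (inside P_{2,omega0}).\<close>
definition W2 :: "'a::euclidean_space measure \<Rightarrow> 'a measure \<Rightarrow> real" where
  "W2 \<mu> \<nu> = sqrt (enn2real (W2sq \<mu> \<nu>))"

definition opt_couplings :: "'a::euclidean_space measure \<Rightarrow> 'a measure \<Rightarrow> ('a \<times> 'a) measure set" where
  "opt_couplings \<mu> \<nu> = {\<gamma>\<in>couplings \<mu> \<nu>. cost \<gamma> = W2sq \<mu> \<nu>}"

definition P2 :: "'a::euclidean_space measure \<Rightarrow> 'a measure set" where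
  "P2 \<omega>0 = {\<mu>\<in>Prob. W2sq \<mu> \<omega>0 < \<infinity>}"

definition plans :: "'a::euclidean_space measure \<Rightarrow> 'a measure \<Rightarrow> 'a measure \<Rightarrow> ('a \<times> 'a \<times> 'a) measure set" where
  "plans \<omega> \<mu>0 \<mu>1 = {w. prob_space w \<and> sets w = sets borel \<and>
      distr w borel (\<lambda>(x1,x2,x3). (x1,x2)) \<in> opt_couplings \<omega> \<mu>0 \<and>
      distr w borel (\<lambda>(x1,x2,x3). (x1,x3)) \<in> opt_couplings \<omega> \<mu>1}"

definition gen_geod :: "('a::euclidean_space \<times> 'a \<times> 'a) measure \<Rightarrow> real \<Rightarrow> 'a measure" where
  "gen_geod w \<alpha> = distr w borel (\<lambda>(x1,x2,x3). (1 - \<alpha>) *\<^sub>R x2 + \<alpha> *\<^sub>R x3)"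

definition W2_plan_sq :: "('a::euclidean_space \<times> 'a \<times> 'a) measure \<Rightarrow> ennreal" where
  "W2_plan_sq w = (\<integral>\<^sup>+ (x1,x2,x3). ennreal ((dist x2 x3)\<^sup>2) \<partial>w)"

definition proper :: "'a::euclidean_space measure \<Rightarrow> ('a measure \<Rightarrow> ereal) \<Rightarrow> bool" where
  "proper \<omega>0 E \<longleftrightarrow> (\<exists>\<mu>\<in>P2 \<omega>0. E \<mu> < \<infinity>)"

definition coercive :: "'a::euclidean_space measure \<Rightarrow> ('a measure \<Rightarrow> ereal) \<Rightarrow> bool" where
  "coercive \<omega>0 E \<longleftrightarrow> (\<exists>\<tau>0>0. \<exists>u0\<in>P2 \<omega>0.
      (INF v\<in>P2 \<omega>0. ereal ((W2 u0 v)\<^sup>2 / (2 * \<tau>0)) + E v) > -\<infinity>)"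

definition lsc_W2 :: "'a::euclidean_space measure \<Rightarrow> ('a measure \<Rightarrow> ereal) \<Rightarrow> bool" where
  "lsc_W2 \<omega>0 E \<longleftrightarrow> (\<forall>\<mu>\<in>P2 \<omega>0. \<forall>s. (\<forall>n. s n \<in> P2 \<omega>0) \<and> (\<lambda>n. W2 (s n) \<mu>) \<longlonglongrightarrow> 0
      \<longrightarrow> E \<mu> \<le> liminf (\<lambda>n. E (s n)))"

definition convex_gen_geod :: "'a::euclidean_space measure \<Rightarrow> ('a measure \<Rightarrow> ereal) \<Rightarrow> real \<Rightarrow> bool" where
  "convex_gen_geod \<omega>0 E lam \<longleftrightarrow> (\<forall>\<mu>0\<in>P2 \<omega>0. \<forall>\<mu>1\<in>P2 \<omega>0. \<forall>\<omega>\<in>P2 \<omega>0.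
      \<exists>w\<in>plans \<omega> \<mu>0 \<mu>1. \<forall>\<alpha>\<in>{0..1}.
        E (gen_geod w \<alpha>) \<le> ereal (1 - \<alpha>) * E \<mu>0 + ereal \<alpha> * E \<mu>1
            - ereal (\<alpha> * (1 - \<alpha>) * lam / 2) * enn2ereal (W2_plan_sq w))"

definition neg_part :: "real \<Rightarrow> real" where
  "neg_part lam = max 0 (- lam)"

definition JKO :: "'a::euclidean_space measure \<Rightarrow> ('a measure \<Rightarrow> ereal) \<Rightarrow> real \<Rightarrow> 'a measure \<Rightarrow> 'a measure" where
  "JKO \<omega>0 E \<tau> \<mu> = (THE \<nu>. \<nu> \<in> P2 \<omega>0 \<and> (\<forall>\<nu>'\<in>P2 \<omega>0.
      ereal ((W2 \<mu> \<nu>)\<^sup>2 / (2 * \<tau>)) + E \<nu> \<le> ereal ((W2 \<mu> \<nu>')\<^sup>2 / (2 * \<tau>)) + E \<nu>'))"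

primrec JKO_var :: "'a::euclidean_space measure \<Rightarrow> ('a measure \<Rightarrow> ereal) \<Rightarrow> (nat \<Rightarrow> real) \<Rightarrow> 'a measure \<Rightarrow> nat \<Rightarrow> 'a measure" where
  "JKO_var \<omega>0 E h \<mu> 0 = \<mu>"
| "JKO_var \<omega>0 E h \<mu> (Suc m) = JKO \<omega>0 E (h (Suc m)) (JKO_var \<omega>0 E h \<mu> m)"

definition slope :: "'a::euclidean_space measure \<Rightarrow> ('a measure \<Rightarrow> ereal) \<Rightarrow> 'a measure \<Rightarrow> ereal" where
  "slope \<omega>0 E \<mu> = (INF r\<in>{0<..}. SUP \<nu>\<in>{\<nu>\<in>P2 \<omega>0. 0 < W2 \<mu> \<nu> \<and> W2 \<mu> \<nu> < r}.
      max 0 (E \<mu> - E \<nu>) / ereal (W2 \<mu> \<nu>))"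

definition dom_slope :: "'a::euclidean_space measure \<Rightarrow> ('a measure \<Rightarrow> ereal) \<Rightarrow> 'a measure set" where
  "dom_slope \<omega>0 E = {\<mu>\<in>P2 \<omega>0. E \<mu> < \<infinity> \<and> slope \<omega>0 E \<mu> < \<infinity>}"

end

theory Submission
  imports Defs
begin

text \<open>
  Convexity along generalized geodesics with base \<open>\<mu>\<close> makes
  \<open>\<nu> \<mapsto> W\<^sub>2\<^sup>2(\<mu>, \<nu>) / (2\<tau>) + E(\<nu>)\<close> uniformly convex, which yields the minimizer and the
  discrete evolution variational inequality. For a \<open>\<tau>\<close>-step and an \<open>h\<close>-step, testing the inequality
  of each with the endpoint of the other gives, with \<open>a(n,m) = W\<^sub>2\<^sup>2(J\<^sup>n, J\<^sup>m)\<close> and \<open>\<kappa> = \<lambda>\<^sup>-\<close>,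
  \<open>(\<tau> + h - 2\<kappa>\<tau>h) a(n,m) \<le> h a(n-1,m) + \<tau> a(n,m-1)\<close>. This recursion is solved by Kobayashi's weights
  \<open>(n\<tau> - S\<^sub>m)\<^sup>2 + n\<tau>\<^sup>2 + \<Sum> h\<^sub>k\<^sup>2\<close>, which are sharper than the bracket in the claim.

  The metric facts come from the plans that the convexity hypothesis supplies: the existence of optimal
  couplings and the triangle inequality need no gluing. Gluing is needed only for the
  completeness of \<open>W\<^sub>2\<close> and for the finiteness of distances, where an approximate version up to a
  constant factor suffices: it conditions a coupling on small cells of its first coordinate.
\<close>

section \<open>Proximal steps in a metric space\<close>

text \<open>Seen from its base, the squared distance is convex along a generalized geodesic, with
  the plan cost as modulus; along ordinary geodesics of \<open>W2\<close> such convexity can fail.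
  The convexity axiom of the locale therefore carries one number \<open>K\<close>, abstracting the
  plan cost, through both of its inequalities. The two occurrences merge into
  \<open>(1 / \<tau> - \<kappa>) / 2 * K\<close>, and only then, with a positive coefficient, may
  \<open>K\<close> be lowered to the squared distance. The recursion for \<open>a(n,m)\<close> needs
  boundary values at \<open>n = 0\<close> and \<open>m = 0\<close>, and these come from the slope: a
  step of size \<open>\<tau>\<close> enlarges a slope bound at most by the factor
  \<open>1 / (1 - \<kappa> * \<tau>)\<close> and moves by at most \<open>\<tau>\<close> times the
  enlarged bound. Hence the powers, the product and the squared slope in the estimate. For
  \<open>\<kappa> = 0\<close> the weights satisfy the recursion with equality; for
  \<open>\<kappa> > 0\<close> the squared growth factors compensate the loss
  \<open>2 * \<kappa> * \<tau> * h\<close> on its left side.\<close>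

locale proximal_space = Metric_space M d for M :: "'a set" and d :: "'a \<Rightarrow> 'a \<Rightarrow> real" +
  fixes D :: "'a set" and f :: "'a \<Rightarrow> real" and \<kappa> :: real
  assumes complete: "mcomplete"
    and D_subset: "D \<subseteq> M" and D_nonempty: "D \<noteq> {}"
    and kappa_nonneg: "0 \<le> \<kappa>"
    and sublevel_closed: "\<And>s c x. \<lbrakk>\<And>n. s n \<in> D; \<And>n. f (s n) \<le> c; x \<in> M; (\<lambda>n. d (s n) x) \<longlonglongrightarrow> 0\<rbrakk>
      \<Longrightarrow> x \<in> D \<and> f x \<le> c"
    and coercivity: "\<exists>\<tau>0>0. \<exists>u\<in>M. \<exists>c. \<forall>v\<in>D. c \<le> (d u v)\<^sup>2 / (2 * \<tau>0) + f v"
    and convexity: "\<And>w x y. \<lbrakk>w \<in> M; x \<in> D; y \<in> D\<rbrakk> \<Longrightarrow> \<exists>g K. (d x y)\<^sup>2 \<le> K \<and>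
      (\<forall>t\<in>{0..1}. g t \<in> D
        \<and> f (g t) \<le> (1 - t) * f x + t * f y + t * (1 - t) * \<kappa> / 2 * K
        \<and> (d w (g t))\<^sup>2 \<le> (1 - t) * (d w x)\<^sup>2 + t * (d w y)\<^sup>2 - t * (1 - t) * K)"
begin

text \<open>Take the base to be the endpoint \<open>x\<close>. Nonnegativity of the squared distance
  from \<open>x\<close> to \<open>g t\<close> forces \<open>(1 - t) * K\<close> below the squared
  distance of the endpoints for every \<open>t > 0\<close>; as \<open>t\<close> tends to 0 the
  excess of \<open>K\<close> vanishes, and what remains is a perfect square.\<close>

lemma convexity_geodesic:
  assumes "x \<in> D" "y \<in> D"
  shows "\<exists>g. \<forall>t\<in>{0..1}. g t \<in> D
    \<and> f (g t) \<le> (1 - t) * f x + t * f y + t * (1 - t) * \<kappa> / 2 * (d x y)\<^sup>2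
    \<and> d x (g t) \<le> t * d x y"
proof -
  have xM: "x \<in> M" using assms D_subset by auto
  obtain g K where K: "(d x y)\<^sup>2 \<le> K" and g: "\<forall>t\<in>{0..1}. g t \<in> D
        \<and> f (g t) \<le> (1 - t) * f x + t * f y + t * (1 - t) * \<kappa> / 2 * K
        \<and> (d x (g t))\<^sup>2 \<le> (1 - t) * (d x x)\<^sup>2 + t * (d x y)\<^sup>2 - t * (1 - t) * K"
    using convexity[OF xM assms] by blast
  have dxx: "d x x = 0" using xM by simp
  have bound: "(1 - t) * K \<le> (d x y)\<^sup>2" if "0 < t" "t \<le> 1" for t
  proof -
    have "t \<in> {0..1}" using that by auto
    then have "(d x (g t))\<^sup>2 \<le> t * (d x y)\<^sup>2 - t * (1 - t) * K" using g dxx by auto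
    then have "0 \<le> t * (d x y)\<^sup>2 - t * (1 - t) * K" using zero_le_power2 order_trans by blast
    then have "0 \<le> t * ((d x y)\<^sup>2 - (1 - t) * K)" by (simp add: algebra_simps)
    then show ?thesis using that by (simp add: zero_le_mult_iff)
  qed
  have "K \<le> (d x y)\<^sup>2"
  proof (rule tendsto_upperbound)
    show "((\<lambda>t. (1 - t) * K) \<longlongrightarrow> K) (at_right 0)"
      by (rule tendsto_eq_intros refl | simp)+
    show "\<forall>\<^sub>F t in at_right 0. (1 - t) * K \<le> (d x y)\<^sup>2"
      by (rule eventually_at_rightI[of 0 1]) (auto intro: bound)
  qed simp
  then have eq: "K = (d x y)\<^sup>2" using K by simp
  show ?thesis
  proof (intro exI ballI conjI)
    fix t :: real assume t: "t \<in> {0..1}"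
    show "g t \<in> D" "f (g t) \<le> (1 - t) * f x + t * f y + t * (1 - t) * \<kappa> / 2 * (d x y)\<^sup>2"
      using g t eq by auto
    have "(d x (g t))\<^sup>2 \<le> t * (d x y)\<^sup>2 - t * (1 - t) * (d x y)\<^sup>2"
      using g t dxx eq by auto
    also have "\<dots> = (t * d x y)\<^sup>2" by (simp add: power2_eq_square algebra_simps)
    finally show "d x (g t) \<le> t * d x y" using t by (auto intro: power2_le_imp_le)
  qed
qed

section \<open>The proximal objective: uniform convexity, uniqueness and existence of
  minimizers\<close>

definition prox_obj :: "real \<Rightarrow> 'a \<Rightarrow> 'a \<Rightarrow> real" where
  "prox_obj \<tau> x y = (d x y)\<^sup>2 / (2 * \<tau>) + f y"

definition is_prox :: "real \<Rightarrow> 'a \<Rightarrow> 'a \<Rightarrow> bool" where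
  "is_prox \<tau> x y \<longleftrightarrow> y \<in> D \<and> (\<forall>z\<in>D. prox_obj \<tau> x y \<le> prox_obj \<tau> x z)"

text \<open>The conclusion keeps \<open>K\<close> because \<open>1 / \<tau> - \<kappa>\<close> has
  no sign yet; passing to the squared distance requires
  \<open>\<kappa> * \<tau> < 1\<close>.\<close>

lemma prox_obj_convexity:
  assumes "0 < \<tau>" "w \<in> M" "x \<in> D" "y \<in> D"
  shows "\<exists>g K. (d x y)\<^sup>2 \<le> K \<and> (\<forall>t\<in>{0..1}. g t \<in> D \<and> prox_obj \<tau> w (g t)
      \<le> (1 - t) * prox_obj \<tau> w x + t * prox_obj \<tau> w y - t * (1 - t) * (1 / \<tau> - \<kappa>) / 2 * K)"
proof -
  obtain g K where K: "(d x y)\<^sup>2 \<le> K" and g: "\<forall>t\<in>{0..1}. g t \<in> D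
        \<and> f (g t) \<le> (1 - t) * f x + t * f y + t * (1 - t) * \<kappa> / 2 * K
        \<and> (d w (g t))\<^sup>2 \<le> (1 - t) * (d w x)\<^sup>2 + t * (d w y)\<^sup>2 - t * (1 - t) * K"
    using convexity[OF assms(2-4)] by blast
  show ?thesis
  proof (intro exI conjI ballI)
    show "(d x y)\<^sup>2 \<le> K" by (rule K)
    fix t :: real assume t: "t \<in> {0..1}"
    show "g t \<in> D" using g t by blast
    have "(d w (g t))\<^sup>2 / (2 * \<tau>) \<le> ((1 - t) * (d w x)\<^sup>2 + t * (d w y)\<^sup>2 - t * (1 - t) * K) / (2 * \<tau>)"
      using g t assms(1) by (intro divide_right_mono) auto
    moreover have "f (g t) \<le> (1 - t) * f x + t * f y + t * (1 - t) * \<kappa> / 2 * K"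
      using g t by blast
    ultimately have "prox_obj \<tau> w (g t) \<le> ((1 - t) * (d w x)\<^sup>2 + t * (d w y)\<^sup>2 - t * (1 - t) * K) / (2 * \<tau>)
      + ((1 - t) * f x + t * f y + t * (1 - t) * \<kappa> / 2 * K)"
      unfolding prox_obj_def by linarith
    also have "\<dots> = (1 - t) * prox_obj \<tau> w x + t * prox_obj \<tau> w y - t * (1 - t) * (1 / \<tau> - \<kappa>) / 2 * K"
      using assms(1) unfolding prox_obj_def by (simp add: field_simps)
    finally show "prox_obj \<tau> w (g t)
      \<le> (1 - t) * prox_obj \<tau> w x + t * prox_obj \<tau> w y - t * (1 - t) * (1 / \<tau> - \<kappa>) / 2 * K" .
  qed
qed

lemma step_rate_pos: "\<lbrakk>0 < \<tau>; \<kappa> * \<tau> < 1\<rbrakk> \<Longrightarrow> 0 < 1 / \<tau> - \<kappa>"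
  by (simp add: field_simps)

text \<open>Move from the minimizer \<open>y\<close> a fraction \<open>t\<close> towards
  \<open>z\<close>: minimality and uniform convexity leave an inequality with a common factor
  \<open>t\<close>; divide by it and let \<open>t\<close> tend to 0. This is the discrete evolution
  variational inequality behind all later estimates.\<close>

lemma prox_variational_inequality:
  assumes "0 < \<tau>" "\<kappa> * \<tau> < 1" "x \<in> M" "is_prox \<tau> x y" "z \<in> D"
  shows "prox_obj \<tau> x y + (1 / \<tau> - \<kappa>) / 2 * (d y z)\<^sup>2 \<le> prox_obj \<tau> x z"
proof -
  have y: "y \<in> D" "\<And>z. z \<in> D \<Longrightarrow> prox_obj \<tau> x y \<le> prox_obj \<tau> x z"
    using assms(4) by (auto simp: is_prox_def)
  obtain g K where K: "(d y z)\<^sup>2 \<le> K" and g: "\<And>t. t \<in> {0..1} \<Longrightarrow> g t \<in> D \<and> prox_obj \<tau> x (g t)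
      \<le> (1 - t) * prox_obj \<tau> x y + t * prox_obj \<tau> x z - t * (1 - t) * (1 / \<tau> - \<kappa>) / 2 * K"
    using prox_obj_convexity[OF assms(1,3) y(1) assms(5)] by blast
  define c where "c = (1 / \<tau> - \<kappa>) / 2"
  have c: "0 < c" using step_rate_pos assms by (simp add: c_def)
  have bound: "prox_obj \<tau> x y + (1 - t) * c * K \<le> prox_obj \<tau> x z" if "0 < t" "t \<le> 1" for t
  proof -
    have t: "t \<in> {0..1}" using that by auto
    have "prox_obj \<tau> x y \<le> (1 - t) * prox_obj \<tau> x y + t * prox_obj \<tau> x z - t * (1 - t) * c * K"
      using y(2)[of "g t"] g[OF t] unfolding c_def by (simp add: algebra_simps)
    then have "0 \<le> t * (prox_obj \<tau> x z - prox_obj \<tau> x y - (1 - t) * c * K)"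
      by (simp add: algebra_simps)
    then show ?thesis using that by (simp add: zero_le_mult_iff)
  qed
  have "prox_obj \<tau> x y + c * K \<le> prox_obj \<tau> x z"
  proof (rule tendsto_upperbound)
    show "((\<lambda>t. prox_obj \<tau> x y + (1 - t) * c * K) \<longlongrightarrow> prox_obj \<tau> x y + c * K) (at_right 0)"
      by (rule tendsto_eq_intros refl | simp)+
    show "\<forall>\<^sub>F t in at_right 0. prox_obj \<tau> x y + (1 - t) * c * K \<le> prox_obj \<tau> x z"
      by (rule eventually_at_rightI[of 0 1]) (auto intro: bound)
  qed simp
  moreover have "c * (d y z)\<^sup>2 \<le> c * K" using K c by simp
  ultimately show ?thesis unfolding c_def by linarith
qed

lemma prox_unique:
  assumes "0 < \<tau>" "\<kappa> * \<tau> < 1" "x \<in> M" "is_prox \<tau> x y" "is_prox \<tau> x z"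
  shows "y = z"
proof -
  have zD: "z \<in> D" and yD: "y \<in> D" and le: "prox_obj \<tau> x z \<le> prox_obj \<tau> x y"
    using assms(4,5) by (auto simp: is_prox_def)
  have "(1 / \<tau> - \<kappa>) / 2 * (d y z)\<^sup>2 \<le> 0"
    using prox_variational_inequality[OF assms(1-4) zD] le by linarith
  then have "d y z = 0"
    using step_rate_pos[OF assms(1,2)] by (auto simp: mult_le_0_iff)
  then show ?thesis using yD zD D_subset zero by blast
qed

text \<open>Coercivity bounds \<open>f\<close> from below on balls; convexity along geodesics issuing from one point of
  the domain propagates this to a lower bound that is quadratic with the critical factor \<open>\<kappa> / 2\<close>.\<close>

lemma quadratic_lower_bound:
  assumes "p \<in> D"
  shows "\<exists>C\<ge>0. \<forall>v\<in>D. - C * (1 + d p v) - \<kappa> / 2 * (d p v)\<^sup>2 \<le> f v"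
proof -
  obtain \<tau>0 u c where \<tau>0: "0 < \<tau>0" and u: "u \<in> M" and c: "\<And>v. v \<in> D \<Longrightarrow> c \<le> (d u v)\<^sup>2 / (2 * \<tau>0) + f v"
    using coercivity by blast
  have pM: "p \<in> M" using assms D_subset by auto
  \<comment> \<open>The unit ball around \<open>p\<close> lies within distance
    \<open>d u p + 1\<close> of the coercivity center \<open>u\<close>, so \<open>m\<close> bounds
    \<open>f\<close> from below on it.\<close>
  define m where "m = c - (d u p + 1)\<^sup>2 / (2 * \<tau>0)"
  have near: "m \<le> f v" if v: "v \<in> D" and "d p v \<le> 1" for v
  proof -
    have "d u v \<le> d u p + 1" using triangle[OF u pM, of v] v D_subset that(2) by auto
    then have "(d u v)\<^sup>2 / (2 * \<tau>0) \<le> (d u p + 1)\<^sup>2 / (2 * \<tau>0)"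
      using \<tau>0 by (intro divide_right_mono power_mono) auto
    then show ?thesis using c[OF v] by (simp add: m_def)
  qed
  define C where "C = \<bar>m\<bar> + \<bar>f p\<bar>"
  show ?thesis
  proof (intro exI[of _ C] conjI ballI)
    show C0: "0 \<le> C" by (simp add: C_def)
    fix v assume v: "v \<in> D"
    show "- C * (1 + d p v) - \<kappa> / 2 * (d p v)\<^sup>2 \<le> f v"
    proof (cases "d p v \<le> 1")
      case True
      have "0 \<le> C * d p v" "0 \<le> \<kappa> / 2 * (d p v)\<^sup>2" using C0 kappa_nonneg by auto
      moreover have "- C \<le> m" by (auto simp: C_def)
      ultimately show ?thesis using near[OF v True] by (simp add: algebra_simps)
    next
      case False
      \<comment> \<open>This fraction puts \<open>g t\<close> into the unit ball around
        \<open>p\<close>; the bound \<open>m\<close> there, divided by \<open>t\<close>, costs only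
        a term linear in \<open>d p v\<close>.\<close>
      define t where "t = 1 / d p v"
      have t: "0 < t" "t \<le> 1" "t * d p v = 1" using False by (auto simp: t_def)
      obtain g where g: "\<And>t. t \<in> {0..1} \<Longrightarrow> g t \<in> D"
        "\<And>t. t \<in> {0..1} \<Longrightarrow> f (g t) \<le> (1 - t) * f p + t * f v + t * (1 - t) * \<kappa> / 2 * (d p v)\<^sup>2"
        "\<And>t. t \<in> {0..1} \<Longrightarrow> d p (g t) \<le> t * d p v"
        using convexity_geodesic[OF assms v] by blast
      have "m \<le> f (g t)" using t g(1,3)[of t] by (intro near) auto
      then have 1: "m - (1 - t) * f p \<le> t * f v + t * (1 - t) * \<kappa> / 2 * (d p v)\<^sup>2"
        using g(2)[of t] t by simp
      have "(1 - t) * f p \<le> 1 * \<bar>f p\<bar>"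
        using t by (intro order_trans[OF mult_left_mono[OF abs_ge_self] mult_right_mono]) auto
      then have "- C \<le> m - (1 - t) * f p" by (simp add: C_def)
      then have "- C \<le> t * (f v + (1 - t) * \<kappa> / 2 * (d p v)\<^sup>2)" using 1 by (simp add: algebra_simps)
      then have "- C * d p v \<le> t * (f v + (1 - t) * \<kappa> / 2 * (d p v)\<^sup>2) * d p v"
        by (intro mult_right_mono) auto
      also have "\<dots> = (t * d p v) * (f v + (1 - t) * \<kappa> / 2 * (d p v)\<^sup>2)" by (simp only: mult_ac)
      also have "\<dots> = f v + (1 - t) * (\<kappa> / 2 * (d p v)\<^sup>2)" by (simp add: t(3))
      also have "\<dots> \<le> f v + 1 * (\<kappa> / 2 * (d p v)\<^sup>2)"
        using t kappa_nonneg by (intro add_left_mono mult_right_mono) auto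
      finally show ?thesis using C0 by (simp add: algebra_simps)
    qed
  qed
qed

text \<open>The negative quadratic part \<open>\<kappa> / 2\<close> of the lower bound for
  \<open>f\<close> is beaten by \<open>1 / (2 * \<tau>)\<close> exactly when
  \<open>\<kappa> * \<tau> < 1\<close>, however small the \<open>\<tau>0\<close> of coercivity is.
  What is left is a quadratic polynomial in \<open>d p v\<close> with positive leading coefficient,
  bounded below by completing the square.\<close>

lemma prox_obj_bdd_below:
  assumes \<tau>: "0 < \<tau>" "\<kappa> * \<tau> < 1" and x: "x \<in> M"
  shows "\<exists>B. \<forall>v\<in>D. B \<le> prox_obj \<tau> x v"
proof -
  obtain p where p: "p \<in> D" using D_nonempty by auto
  then have pM: "p \<in> M" using D_subset by auto
  obtain C where C: "0 \<le> C" "\<And>v. v \<in> D \<Longrightarrow> - C * (1 + d p v) - \<kappa> / 2 * (d p v)\<^sup>2 \<le> f v"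
    using quadratic_lower_bound[OF p] by blast
  define r where "r = d p x"
  define e where "e = (1 / \<tau> - \<kappa>) / 2"
  have e: "0 < e" using step_rate_pos[OF \<tau>] by (simp add: e_def)
  \<comment> \<open>The linear coefficient collects \<open>C\<close> from the bound for
    \<open>f\<close> and \<open>r / \<tau>\<close> from expanding
    \<open>(q - r)\<^sup>2 / (2 * \<tau>)\<close>.\<close>
  define L where "L = C + r / \<tau>"
  have "- C - L\<^sup>2 / (4 * e) \<le> prox_obj \<tau> x v" if v: "v \<in> D" for v
  proof -
    have vM: "v \<in> M" using v D_subset by auto
    define q where "q = d p v"
    have "q \<le> r + d x v" using triangle[OF pM x vM] by (simp add: q_def r_def)
    moreover have "r \<le> q + d x v" using triangle[OF pM vM x] commute[of v x] by (simp add: q_def r_def)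
    ultimately have "\<bar>q - r\<bar> \<le> \<bar>d x v\<bar>" by simp
    then have "(q - r)\<^sup>2 \<le> (d x v)\<^sup>2" by (simp only: abs_le_square_iff)
    then have "(q - r)\<^sup>2 / (2 * \<tau>) \<le> (d x v)\<^sup>2 / (2 * \<tau>)" using \<tau> by (intro divide_right_mono) auto
    then have "(q - r)\<^sup>2 / (2 * \<tau>) - C * (1 + q) - \<kappa> / 2 * q\<^sup>2 \<le> prox_obj \<tau> x v"
      using C(2)[OF v] by (simp add: prox_obj_def q_def)
    moreover have "(q - r)\<^sup>2 / (2 * \<tau>) - C * (1 + q) - \<kappa> / 2 * q\<^sup>2
      = e * q\<^sup>2 - L * q - C + r\<^sup>2 / (2 * \<tau>)"
      using \<tau> by (simp add: e_def L_def power2_eq_square field_simps)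
    moreover have "0 \<le> r\<^sup>2 / (2 * \<tau>)" using \<tau> by simp
    moreover have "e * q\<^sup>2 - L * q + L\<^sup>2 / (4 * e) = e * (q - L / (2 * e))\<^sup>2"
      using e by (simp add: power2_eq_square field_simps)
    moreover have "0 \<le> e * (q - L / (2 * e))\<^sup>2" using e by simp
    ultimately show ?thesis by linarith
  qed
  then show ?thesis by blast
qed

text \<open>No compactness is involved: uniform convexity makes a minimizing sequence Cauchy,
  completeness supplies its limit, and closedness of sublevels identifies that limit as a
  minimizer.\<close>

lemma prox_exists:
  assumes \<tau>: "0 < \<tau>" "\<kappa> * \<tau> < 1" and x: "x \<in> M"
  shows "\<exists>y. is_prox \<tau> x y"
proof -
  obtain B where B: "\<And>v. v \<in> D \<Longrightarrow> B \<le> prox_obj \<tau> x v" using prox_obj_bdd_below[OF assms] by blast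
  define I where "I = (INF v\<in>D. prox_obj \<tau> x v)"
  have bdd: "bdd_below (prox_obj \<tau> x ` D)" using B by (auto simp: bdd_below_def)
  have I: "I \<le> prox_obj \<tau> x v" if "v \<in> D" for v
    unfolding I_def using bdd that by (rule cINF_lower)
  have "\<exists>v\<in>D. prox_obj \<tau> x v < I + 1 / Suc n" for n
    using cINF_less_iff[OF D_nonempty bdd, of "I + 1 / Suc n"] by (simp add: I_def)
  then obtain s where s: "\<And>n. s n \<in> D" "\<And>n. prox_obj \<tau> x (s n) < I + 1 / Suc n"
    by metis
  have sM: "s n \<in> M" for n using s(1) D_subset by auto
  define e where "e = (1 / \<tau> - \<kappa>) / 2"
  have e: "0 < e" using step_rate_pos[OF \<tau>] by (simp add: e_def)
  \<comment> \<open>Test with the midpoint, where \<open>t * (1 - t) = 1 / 4\<close>: its objective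
    value is at least \<open>I\<close>, while both endpoints exceed \<open>I\<close> by less than
    \<open>1 / Suc N\<close>.\<close>
  have near: "e / 4 * (d (s n) (s n'))\<^sup>2 \<le> 1 / Suc N" if "N \<le> n" "N \<le> n'" for n n' N
  proof -
    obtain g K where K: "(d (s n) (s n'))\<^sup>2 \<le> K" and g: "\<And>t. t \<in> {0..1} \<Longrightarrow> g t \<in> D \<and> prox_obj \<tau> x (g t)
      \<le> (1 - t) * prox_obj \<tau> x (s n) + t * prox_obj \<tau> x (s n') - t * (1 - t) * (1 / \<tau> - \<kappa>) / 2 * K"
      using prox_obj_convexity[OF \<tau>(1) x s(1)[of n] s(1)[of n']] by blast
    have "I \<le> prox_obj \<tau> x (g (1/2))" by (rule I) (simp add: g)
    also have "\<dots> \<le> prox_obj \<tau> x (s n) / 2 + prox_obj \<tau> x (s n') / 2 - e / 4 * K"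
      using g[of "1/2"] by (simp add: e_def)
    finally have "e / 4 * K \<le> prox_obj \<tau> x (s n) / 2 + prox_obj \<tau> x (s n') / 2 - I" by simp
    moreover have "e / 4 * (d (s n) (s n'))\<^sup>2 \<le> e / 4 * K" using K e by simp
    moreover have "1 / real (Suc n) \<le> 1 / Suc N" "1 / real (Suc n') \<le> 1 / Suc N"
      using that by (auto simp: field_simps)
    ultimately show ?thesis using s(2)[of n] s(2)[of n'] by linarith
  qed
  have "MCauchy s"
    unfolding MCauchy_def
  proof (intro conjI allI impI)
    show "range s \<subseteq> M" using sM by auto
    fix \<epsilon> :: real assume \<epsilon>: "0 < \<epsilon>"
    then obtain N where N: "1 / Suc N < e / 4 * \<epsilon>\<^sup>2"
      using e reals_Archimedean[of "e / 4 * \<epsilon>\<^sup>2"] by (auto simp: inverse_eq_divide)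
    have "d (s n) (s n') < \<epsilon>" if "N \<le> n" "N \<le> n'" for n n'
    proof -
      have "e / 4 * (d (s n) (s n'))\<^sup>2 < e / 4 * \<epsilon>\<^sup>2" using near[OF that] N by linarith
      then have "(d (s n) (s n'))\<^sup>2 < \<epsilon>\<^sup>2" using e by simp
      then show ?thesis using \<epsilon> by (auto intro: power2_less_imp_less)
    qed
    then show "\<exists>N. \<forall>n n'. N \<le> n \<longrightarrow> N \<le> n' \<longrightarrow> d (s n) (s n') < \<epsilon>" by blast
  qed
  then obtain y where y: "limitin mtopology s y sequentially"
    using complete by (auto simp: mcomplete_def)
  then have yM: "y \<in> M" and sy: "(\<lambda>n. d (s n) y) \<longlonglongrightarrow> 0"
    by (auto simp: limitin_metric_dist_null)
  have "\<bar>d x (s n) - d x y\<bar> \<le> d (s n) y" for n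
    using triangle[OF x sM yM, of n] triangle[OF x yM sM, of n] commute[of y "s n"] by linarith
  then have "(\<lambda>n. d x (s n) - d x y) \<longlonglongrightarrow> 0"
    by (intro Lim_null_comparison[OF _ sy] always_eventually) simp
  then have dxs: "(\<lambda>n. d x (s n)) \<longlonglongrightarrow> d x y" by (simp add: LIM_zero_iff)
  have lim: "(\<lambda>n. I + 1 / Suc n - (d x (s n))\<^sup>2 / (2 * \<tau>)) \<longlonglongrightarrow> I + 0 - (d x y)\<^sup>2 / (2 * \<tau>)"
    using \<tau> by (intro tendsto_intros dxs LIMSEQ_Suc[OF lim_1_over_n]) auto
  \<comment> \<open>Sublevels of \<open>f\<close> are closed, but those of the objective are only
    approached at the varying levels
    \<open>I + 1 / Suc n - (d x (s n))\<^sup>2 / (2 * \<tau>)\<close>. These levels converge, so a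
    tail of the sequence lies in one sublevel of \<open>f\<close>, up to
    \<open>\<epsilon>\<close>.\<close>
  have le: "y \<in> D \<and> f y \<le> I - (d x y)\<^sup>2 / (2 * \<tau>) + \<epsilon>" if "0 < \<epsilon>" for \<epsilon>
  proof -
    have "\<forall>\<^sub>F n in sequentially. I + 1 / Suc n - (d x (s n))\<^sup>2 / (2 * \<tau>) < I - (d x y)\<^sup>2 / (2 * \<tau>) + \<epsilon>"
      using that by (intro order_tendstoD(2)[OF lim]) simp
    then obtain N where N: "\<And>n. N \<le> n \<Longrightarrow> I + 1 / Suc n - (d x (s n))\<^sup>2 / (2 * \<tau>) < I - (d x y)\<^sup>2 / (2 * \<tau>) + \<epsilon>"
      by (auto simp: eventually_sequentially)
    show ?thesis
    proof (rule sublevel_closed[where s = "\<lambda>n. s (n + N)"])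
      show "f (s (n + N)) \<le> I - (d x y)\<^sup>2 / (2 * \<tau>) + \<epsilon>" for n
        using N[of "n + N"] s(2)[of "n + N"] unfolding prox_obj_def by linarith
      show "(\<lambda>n. d (s (n + N)) y) \<longlonglongrightarrow> 0" using LIMSEQ_ignore_initial_segment[OF sy] .
    qed (use s yM in auto)
  qed
  then have "y \<in> D" using zero_less_one by blast
  moreover have "prox_obj \<tau> x y \<le> I"
  proof (rule field_le_epsilon)
    fix \<epsilon> :: real assume "0 < \<epsilon>"
    then show "prox_obj \<tau> x y \<le> I + \<epsilon>" using le[of \<epsilon>] by (simp add: prox_obj_def)
  qed
  ultimately show ?thesis using I by (force simp: is_prox_def)
qed

section \<open>Slope bounds and their growth along proximal steps\<close>

definition slope_bound :: "'a \<Rightarrow> real \<Rightarrow> bool" where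
  "slope_bound x s \<longleftrightarrow> x \<in> D \<and> 0 \<le> s \<and> (\<forall>y\<in>D. f x \<le> f y + s * d x y + \<kappa> / 2 * (d x y)\<^sup>2)"

text \<open>Convexity turns a local descent rate into a global one: slide from \<open>x\<close>
  along the geodesic to \<open>y\<close> until the distance is below \<open>r\<close>, then divide
  by \<open>t\<close>. The global form contains no limit and so passes through a proximal
  step.\<close>

lemma slope_bound_if_local:
  assumes x: "x \<in> D" and s: "0 \<le> s" and r: "0 < r"
    and local: "\<And>y. \<lbrakk>y \<in> D; d x y < r\<rbrakk> \<Longrightarrow> f x - f y \<le> s * d x y"
  shows "slope_bound x s"
  unfolding slope_bound_def
proof (intro conjI ballI)
  fix y assume y: "y \<in> D"
  define q where "q = d x y"
  have q: "0 \<le> q" by (simp add: q_def)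
  \<comment> \<open>Adding 1 to \<open>q\<close> keeps the denominator positive even for
    \<open>y = x\<close>.\<close>
  define t where "t = min 1 (r / (2 * (q + 1)))"
  have t: "0 < t" "t \<le> 1" "t \<in> {0..1}" using r q by (auto simp: t_def)
  have "t * q \<le> r / (2 * (q + 1)) * q" using q by (intro mult_right_mono) (auto simp: t_def)
  also have "\<dots> < r"
  proof -
    have "r * q < r * (2 * (q + 1))" using r q by simp
    then show ?thesis using q by (simp add: field_simps)
  qed
  finally have tq: "t * q < r" .
  obtain g where g: "\<And>t. t \<in> {0..1} \<Longrightarrow> g t \<in> D"
      "\<And>t. t \<in> {0..1} \<Longrightarrow> f (g t) \<le> (1 - t) * f x + t * f y + t * (1 - t) * \<kappa> / 2 * q\<^sup>2"
      "\<And>t. t \<in> {0..1} \<Longrightarrow> d x (g t) \<le> t * q"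
    using convexity_geodesic[OF x y] unfolding q_def by blast
  have "f x - f (g t) \<le> s * d x (g t)" using g(1)[OF t(3)] g(3)[OF t(3)] tq by (intro local) auto
  also have "\<dots> \<le> s * (t * q)" using g(3)[OF t(3)] s by (intro mult_left_mono)
  finally have "0 \<le> t * (f y + s * q + (1 - t) * \<kappa> / 2 * q\<^sup>2 - f x)"
    using g(2)[OF t(3)] by (simp add: algebra_simps)
  then have "f x \<le> f y + s * q + (1 - t) * (\<kappa> / 2 * q\<^sup>2)" using t by (simp add: zero_le_mult_iff)
  also have "\<dots> \<le> f y + s * q + 1 * (\<kappa> / 2 * q\<^sup>2)"
    using t kappa_nonneg by (intro add_left_mono mult_right_mono) auto
  finally show "f x \<le> f y + s * d x y + \<kappa> / 2 * (d x y)\<^sup>2" by (simp add: q_def)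
qed (use x s in auto)

text \<open>Test the variational inequality with the starting point \<open>x\<close> itself. It
  bounds the decrease \<open>f x - f y\<close> from below by
  \<open>(1 / \<tau> - \<kappa> / 2)\<close> times the squared step, the slope bound limits it from
  above, and one factor \<open>d x y\<close> cancels.\<close>

lemma prox_displacement:
  assumes \<tau>: "0 < \<tau>" "\<kappa> * \<tau> < 1" and x: "slope_bound x s" and y: "is_prox \<tau> x y"
  shows "d x y \<le> \<tau> * (s / (1 - \<kappa> * \<tau>))"
proof -
  have xD: "x \<in> D" and yD: "y \<in> D" and s: "0 \<le> s"
    and sl: "f x \<le> f y + s * d x y + \<kappa> / 2 * (d x y)\<^sup>2"
    using x y by (auto simp: slope_bound_def is_prox_def)
  have xM: "x \<in> M" using xD D_subset by auto
  have "(d x y)\<^sup>2 / (2 * \<tau>) + f y + (1 / \<tau> - \<kappa>) / 2 * (d x y)\<^sup>2 \<le> f x"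
    using prox_variational_inequality[OF \<tau> xM y xD] xM commute[of y x] by (simp add: prox_obj_def)
  then have "(1 / \<tau> - \<kappa>) * (d x y)\<^sup>2 \<le> s * d x y" using sl by (simp add: field_simps)
  then have "d x y * ((1 / \<tau> - \<kappa>) * d x y - s) \<le> 0" by (simp add: power2_eq_square algebra_simps)
  then have "(1 / \<tau> - \<kappa>) * d x y \<le> s \<or> d x y = 0"
    using nonneg[of x y] by (auto simp: mult_le_0_iff)
  then have "(1 / \<tau> - \<kappa>) * d x y \<le> s" using s by auto
  then show ?thesis using \<tau> by (simp add: field_simps)
qed

text \<open>By the triangle inequality and the variational inequality the terms
  \<open>q\<^sup>2 / (2 * \<tau>)\<close> cancel, so \<open>p / \<tau>\<close>, the speed of the
  step, bounds the slope at its endpoint; the displacement estimate then bounds the speed.\<close>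

lemma prox_slope_bound:
  assumes \<tau>: "0 < \<tau>" "\<kappa> * \<tau> < 1" and x: "slope_bound x s" and y: "is_prox \<tau> x y"
  shows "slope_bound y (s / (1 - \<kappa> * \<tau>))"
  unfolding slope_bound_def
proof (intro conjI ballI)
  have xM: "x \<in> M" and yM: "y \<in> M" using x y D_subset by (auto simp: slope_bound_def is_prox_def)
  show "y \<in> D" using y by (simp add: is_prox_def)
  show "0 \<le> s / (1 - \<kappa> * \<tau>)" using x \<tau> by (simp add: slope_bound_def)
  fix z assume z: "z \<in> D"
  then have zM: "z \<in> M" using D_subset by auto
  define p q where "p = d x y" and "q = d y z"
  have "(d x z)\<^sup>2 \<le> (p + q)\<^sup>2" unfolding p_def q_def by (intro power_mono triangle xM yM zM) simp
  then have "(d x z)\<^sup>2 / (2 * \<tau>) \<le> (p + q)\<^sup>2 / (2 * \<tau>)" using \<tau> by (intro divide_right_mono) auto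
  moreover have "p\<^sup>2 / (2 * \<tau>) + f y + (1 / \<tau> - \<kappa>) / 2 * q\<^sup>2 \<le> (d x z)\<^sup>2 / (2 * \<tau>) + f z"
    using prox_variational_inequality[OF \<tau> xM y z] by (simp add: prox_obj_def p_def q_def)
  ultimately have "f y \<le> f z + ((p + q)\<^sup>2 / (2 * \<tau>) - p\<^sup>2 / (2 * \<tau>) - (1 / \<tau> - \<kappa>) / 2 * q\<^sup>2)"
    by linarith
  also have "(p + q)\<^sup>2 / (2 * \<tau>) - p\<^sup>2 / (2 * \<tau>) - (1 / \<tau> - \<kappa>) / 2 * q\<^sup>2 = p / \<tau> * q + \<kappa> / 2 * q\<^sup>2"
    using \<tau> by (simp add: field_simps power2_eq_square)
  finally have "f y \<le> f z + p / \<tau> * q + \<kappa> / 2 * q\<^sup>2" by simp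
  moreover have "p / \<tau> * q \<le> s / (1 - \<kappa> * \<tau>) * q"
  proof (rule mult_right_mono)
    show "p / \<tau> \<le> s / (1 - \<kappa> * \<tau>)"
      using prox_displacement[OF \<tau> x y] \<tau> by (simp add: p_def pos_divide_le_eq mult.commute)
  qed (simp add: q_def)
  ultimately show "f y \<le> f z + s / (1 - \<kappa> * \<tau>) * d y z + \<kappa> / 2 * (d y z)\<^sup>2"
    by (simp add: q_def)
qed

text \<open>Testing the variational inequality of each step with the endpoint of the other one cancels
  the values of \<open>f\<close>.\<close>

lemma prox_pair_inequality:
  assumes \<tau>: "0 < \<tau>" "\<kappa> * \<tau> < 1" and h: "0 < h" "\<kappa> * h < 1" and x: "x \<in> M" and u: "u \<in> M"
    and y: "is_prox \<tau> x y" and v: "is_prox h u v"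
  shows "(\<tau> + h - 2 * \<kappa> * \<tau> * h) * (d y v)\<^sup>2 \<le> h * (d x v)\<^sup>2 + \<tau> * (d y u)\<^sup>2"
proof -
  have D: "y \<in> D" "v \<in> D" using y v by (auto simp: is_prox_def)
  have "(d x y)\<^sup>2 / (2 * \<tau>) + f y + (1 / \<tau> - \<kappa>) / 2 * (d y v)\<^sup>2 \<le> (d x v)\<^sup>2 / (2 * \<tau>) + f v"
    using prox_variational_inequality[OF \<tau> x y D(2)] by (simp add: prox_obj_def)
  moreover have "(d u v)\<^sup>2 / (2 * h) + f v + (1 / h - \<kappa>) / 2 * (d y v)\<^sup>2 \<le> (d y u)\<^sup>2 / (2 * h) + f y"
    using prox_variational_inequality[OF h u v D(1)] commute[of v y] commute[of u y]
    by (simp add: prox_obj_def)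
  moreover have "0 \<le> (d x y)\<^sup>2 / (2 * \<tau>)" "0 \<le> (d u v)\<^sup>2 / (2 * h)" using \<tau> h by auto
  ultimately have "(1 / \<tau> - \<kappa>) / 2 * (d y v)\<^sup>2 + (1 / h - \<kappa>) / 2 * (d y v)\<^sup>2
      \<le> (d x v)\<^sup>2 / (2 * \<tau>) + (d y u)\<^sup>2 / (2 * h)" by linarith
  then have "2 * \<tau> * h * ((1 / \<tau> - \<kappa>) / 2 * (d y v)\<^sup>2 + (1 / h - \<kappa>) / 2 * (d y v)\<^sup>2)
      \<le> 2 * \<tau> * h * ((d x v)\<^sup>2 / (2 * \<tau>) + (d y u)\<^sup>2 / (2 * h))"
    using \<tau> h by (intro mult_left_mono) auto
  moreover have "2 * \<tau> * h * ((1 / \<tau> - \<kappa>) / 2 * q + (1 / h - \<kappa>) / 2 * q)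
      = (\<tau> + h - 2 * \<kappa> * \<tau> * h) * q" for q
    using \<tau> h by (simp add: field_simps)
  moreover have "2 * \<tau> * h * (q / (2 * \<tau>) + q' / (2 * h)) = h * q + \<tau> * q'" for q q'
    using \<tau> h by (simp add: field_simps)
  ultimately show ?thesis by simp
qed

lemma prox_orbit_slope_bound:
  assumes x: "slope_bound (z 0) s" and h: "\<And>k. 0 < h (Suc k)" "\<And>k. \<kappa> * h (Suc k) < 1"
    and z: "\<And>k. is_prox (h (Suc k)) (z k) (z (Suc k))"
  shows "slope_bound (z m) (s * (\<Prod>k=1..m. 1 / (1 - \<kappa> * h k)))"
proof (induction m)
  case 0
  then show ?case using x by simp
next
  case (Suc m)
  then show ?case using prox_slope_bound[OF h Suc z[of m]] by simp
qed

text \<open>The slope bounds grow along the orbit, so every step is charged at the last one; the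
  total length then factors into elapsed time and a single product.\<close>

lemma prox_orbit_displacement:
  assumes x: "slope_bound (z 0) s" and h: "\<And>k. 0 < h (Suc k)" "\<And>k. \<kappa> * h (Suc k) < 1"
    and z: "\<And>k. is_prox (h (Suc k)) (z k) (z (Suc k))"
  shows "d (z 0) (z m) \<le> (\<Sum>k=1..m. h k) * (s * (\<Prod>k=1..m. 1 / (1 - \<kappa> * h k)))"
proof (induction m)
  have "z 0 \<in> M" using x D_subset by (auto simp: slope_bound_def)
  then show "d (z 0) (z 0) \<le> (\<Sum>k=1..0. h k) * (s * (\<Prod>k=1..0. 1 / (1 - \<kappa> * h k)))" by simp
next
  case (Suc m)
  define P where "P m = s * (\<Prod>k=1..m. 1 / (1 - \<kappa> * h k))" for m
  define S where "S m = (\<Sum>k=1..m. h k)" for m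
  have sl: "slope_bound (z k) (P k)" for k
    unfolding P_def using prox_orbit_slope_bound[OF assms] .
  then have zM: "z k \<in> M" for k using D_subset by (auto simp: slope_bound_def)
  have P0: "0 \<le> P k" for k using sl by (auto simp: slope_bound_def)
  have PSuc: "P (Suc m) = P m / (1 - \<kappa> * h (Suc m))" by (simp add: P_def)
  have a: "0 < 1 - \<kappa> * h (Suc m)" "1 - \<kappa> * h (Suc m) \<le> 1"
    using h[of m] kappa_nonneg by auto
  have Pmono: "P m \<le> P (Suc m)"
    unfolding PSuc using a P0[of m] by (simp add: pos_le_divide_eq mult_left_le)
  \<comment> \<open>Positivity is known for indices \<open>Suc k\<close>, and the sum starts at 1,
    hence the shift to \<open>k - 1\<close>.\<close>
  have S0: "0 \<le> S m" unfolding S_def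
  proof (rule sum_nonneg)
    show "0 \<le> h k" if "k \<in> {1..m}" for k using that h(1)[of "k - 1"] by auto
  qed
  have "d (z 0) (z (Suc m)) \<le> d (z 0) (z m) + d (z m) (z (Suc m))" by (intro triangle zM)
  also have "\<dots> \<le> S m * P m + h (Suc m) * P (Suc m)"
    using Suc prox_displacement[OF h sl z] by (intro add_mono) (auto simp: P_def S_def)
  also have "\<dots> \<le> S m * P (Suc m) + h (Suc m) * P (Suc m)"
    using S0 Pmono by (intro add_right_mono mult_left_mono)
  also have "\<dots> = S (Suc m) * P (Suc m)" by (simp add: S_def algebra_simps)
  finally show ?case by (simp add: P_def S_def)
qed

end

text \<open>Here \<open>b\<close> is the weight at \<open>(n, m)\<close> and \<open>c\<close> the
  difference of elapsed times \<open>n * \<tau> - S m\<close>; lowering \<open>n\<close> or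
  \<open>m\<close> by one changes the weight to \<open>b - 2 * c * \<tau>\<close> or
  \<open>b + 2 * c * h\<close>. The squared factors are the ratios of the slope factors at the two
  predecessors. The hypothesis \<open>2 * c * \<tau> \<le> b\<close> is nonnegativity of the first
  predecessor weight.\<close>

lemma kobayashi_weight_step:
  fixes \<tau> h \<kappa> b c :: real
  assumes h: "0 < h" "h \<le> \<tau>" and \<kappa>: "0 \<le> \<kappa>" "\<kappa> * \<tau> < 1" and b: "0 \<le> b" "2 * c * \<tau> \<le> b"
  shows "h * ((1 - \<kappa> * \<tau>)\<^sup>2 * (b - 2 * c * \<tau>)) + \<tau> * ((1 - \<kappa> * h)\<^sup>2 * (b + 2 * c * h))
    \<le> (\<tau> + h - 2 * \<kappa> * \<tau> * h) * b"
proof -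
  have "\<kappa> * h \<le> \<kappa> * \<tau>" using h \<kappa> by (intro mult_left_mono)
  then have le2: "0 \<le> 2 - \<kappa> * \<tau> - \<kappa> * h" using \<kappa> by linarith
  \<comment> \<open>The right side minus the left side of the claim is exactly
    \<open>\<kappa> * h * \<tau> * F\<close>.\<close>
  define F where "F = (2 - \<kappa> * \<tau> - \<kappa> * h) * b - 2 * c * ((2 - \<kappa> * \<tau>) * \<tau> - (2 - \<kappa> * h) * h)"
  \<comment> \<open>For \<open>c \<ge> 0\<close> the negative term is absorbed by
    \<open>2 * c * \<tau> \<le> b\<close>. For \<open>c < 0\<close> it has the favorable sign, by
    factoring out \<open>\<tau> - h\<close>; this is where \<open>h \<le> \<tau>\<close>
    decides.\<close>
  have "0 \<le> F"
  proof (cases "0 \<le> c")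
    case True
    have "(2 - \<kappa> * \<tau> - \<kappa> * h) * (2 * c * \<tau>) \<le> (2 - \<kappa> * \<tau> - \<kappa> * h) * b"
      using le2 b by (intro mult_left_mono)
    then have "2 * c * h * (2 - \<kappa> * \<tau> - \<kappa> * h) \<le> F" by (simp add: F_def algebra_simps)
    moreover have "0 \<le> 2 * c * h * (2 - \<kappa> * \<tau> - \<kappa> * h)" using True le2 h by (intro mult_nonneg_nonneg) auto
    ultimately show ?thesis by linarith
  next
    case False
    have "(2 - \<kappa> * \<tau>) * \<tau> - (2 - \<kappa> * h) * h = (\<tau> - h) * (2 - \<kappa> * \<tau> - \<kappa> * h)"
      by (simp add: algebra_simps)
    then have "0 \<le> (2 - \<kappa> * \<tau>) * \<tau> - (2 - \<kappa> * h) * h" using h le2 by simp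
    then have "2 * c * ((2 - \<kappa> * \<tau>) * \<tau> - (2 - \<kappa> * h) * h) \<le> 0" using False by (simp add: mult_nonpos_nonneg)
    moreover have "0 \<le> (2 - \<kappa> * \<tau> - \<kappa> * h) * b" using le2 b by simp
    ultimately show ?thesis by (simp add: F_def)
  qed
  then have "0 \<le> \<kappa> * h * \<tau> * F" using h \<kappa> by (intro mult_nonneg_nonneg) auto
  also have "\<kappa> * h * \<tau> * F = (\<tau> + h - 2 * \<kappa> * \<tau> * h) * b
    - (h * ((1 - \<kappa> * \<tau>)\<^sup>2 * (b - 2 * c * \<tau>)) + \<tau> * ((1 - \<kappa> * h)\<^sup>2 * (b + 2 * c * h)))"
    by (simp add: F_def power2_eq_square algebra_simps)
  finally show ?thesis by simp
qed

section \<open>Double induction over the two orbits\<close>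

context proximal_space
begin

lemma prox_orbit_estimate:
  assumes x: "slope_bound x s" and \<tau>: "\<kappa> * \<tau> < 1" and h: "\<And>k. 0 < h (Suc k)" "\<And>k. h (Suc k) \<le> \<tau>"
    and y: "y 0 = x" "\<And>k. is_prox \<tau> (y k) (y (Suc k))"
    and z: "z 0 = x" "\<And>k. is_prox (h (Suc k)) (z k) (z (Suc k))"
  shows "(d (y n) (z m))\<^sup>2 \<le> ((real n * \<tau> - (\<Sum>k=1..m. h k))\<^sup>2 + real n * \<tau>\<^sup>2 + (\<Sum>k=1..m. (h k)\<^sup>2))
    * ((1 / (1 - \<kappa> * \<tau>)) ^ n)\<^sup>2 * (\<Prod>k=1..m. 1 / (1 - \<kappa> * h k))\<^sup>2 * s\<^sup>2"
proof -
  define S where "S m = (\<Sum>k=1..m. h k)" for m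
  define T where "T m = (\<Sum>k=1..m. (h k)\<^sup>2)" for m
  define P where "P m = (\<Prod>k=1..m. 1 / (1 - \<kappa> * h k))" for m
  define A where "A n = (1 / (1 - \<kappa> * \<tau>)) ^ n" for n :: nat
  define B where "B n m = (real n * \<tau> - S m)\<^sup>2 + real n * \<tau>\<^sup>2 + T m" for n m
  have \<tau>0: "0 < \<tau>" using h[of 0] by linarith
  have h\<kappa>: "\<kappa> * h (Suc k) < 1" for k
    using mult_left_mono[OF h(2)[of k] kappa_nonneg] \<tau> by linarith
  have xM: "x \<in> M" using x D_subset by (auto simp: slope_bound_def)
  have yM: "y k \<in> M" for k using y xM D_subset by (cases k) (auto simp: is_prox_def)
  have zM: "z k \<in> M" for k using z xM D_subset by (cases k) (auto simp: is_prox_def)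
  have T0: "0 \<le> T m" for m by (simp add: T_def sum_nonneg)
  have B0: "0 \<le> B n m" for n m by (simp add: B_def T0)
  have "(d (y n) (z m))\<^sup>2 \<le> B n m * ((A n)\<^sup>2 * (P m)\<^sup>2 * s\<^sup>2)" for n m
  proof (induction n arbitrary: m)
    case 0
    have "d (y 0) (z m) \<le> S m * (s * P m)"
      using prox_orbit_displacement[of z s h m] x h h\<kappa> z y by (simp add: S_def P_def)
    then have "(d (y 0) (z m))\<^sup>2 \<le> (S m * (s * P m))\<^sup>2" by (intro power_mono) auto
    also have "\<dots> = (S m)\<^sup>2 * ((A 0)\<^sup>2 * (P m)\<^sup>2 * s\<^sup>2)" by (simp add: A_def power_mult_distrib)
    also have "\<dots> \<le> B 0 m * ((A 0)\<^sup>2 * (P m)\<^sup>2 * s\<^sup>2)"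
      using T0 by (intro mult_right_mono) (auto simp: B_def)
    finally show ?case .
  next
    case (Suc n)
    \<comment> \<open>The outer hypothesis, valid for every \<open>m\<close>, is saved before the
      inner induction: the predecessor \<open>(n, Suc m)\<close> comes from it, the predecessor
      \<open>(Suc n, m)\<close> from the inner one.\<close>
    note IH1 = Suc.IH
    show ?case
    proof (induction m)
      case 0
      have "d (y 0) (y (Suc n)) \<le> (real (Suc n) * \<tau>) * (s * A (Suc n))"
        using prox_orbit_displacement[of y s "\<lambda>_. \<tau>" "Suc n"] x \<tau>0 \<tau> y
        by (simp add: A_def power_one_over)
      then have "(d (y (Suc n)) (z 0))\<^sup>2 \<le> ((real (Suc n) * \<tau>) * (s * A (Suc n)))\<^sup>2"
        using y z commute[of x] by (intro power_mono) auto
      also have "\<dots> = (real (Suc n) * \<tau>)\<^sup>2 * ((A (Suc n))\<^sup>2 * (P 0)\<^sup>2 * s\<^sup>2)"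
        by (simp add: P_def power_mult_distrib)
      also have "\<dots> \<le> B (Suc n) 0 * ((A (Suc n))\<^sup>2 * (P 0)\<^sup>2 * s\<^sup>2)"
        by (intro mult_right_mono) (auto simp: B_def S_def T_def)
      finally show ?case .
    next
      case (Suc m)
      define k where "k = h (Suc m)"
      define Q where "Q = (A (Suc n))\<^sup>2 * (P (Suc m))\<^sup>2 * s\<^sup>2"
      define c where "c = real (Suc n) * \<tau> - S (Suc m)"
      define b where "b = B (Suc n) (Suc m)"
      have k: "0 < k" "k \<le> \<tau>" "\<kappa> * k < 1" using h h\<kappa> by (auto simp: k_def)
      have Q0: "0 \<le> Q" by (simp add: Q_def)
      \<comment> \<open>Both predecessors are expressed through the factors at
        \<open>(Suc n, Suc m)\<close>, so that the common factor \<open>Q\<close> splits off and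
        only the weight inequality remains.\<close>
      have A: "A n = (1 - \<kappa> * \<tau>) * A (Suc n)" using \<tau> by (simp add: A_def)
      have P: "P m = (1 - \<kappa> * k) * P (Suc m)" using k by (simp add: P_def k_def)
      have b1: "B n (Suc m) = b - 2 * c * \<tau>"
        by (simp add: B_def b_def c_def power2_eq_square algebra_simps)
      have b2: "B (Suc n) m = b + 2 * c * k"
        by (simp add: B_def b_def c_def k_def S_def T_def power2_eq_square algebra_simps)
      have pos: "0 < \<tau> + k - 2 * \<kappa> * \<tau> * k"
      proof -
        have "0 < \<tau> * (1 - \<kappa> * k) + k * (1 - \<kappa> * \<tau>)" using \<tau>0 k \<tau> by (intro add_pos_pos mult_pos_pos) auto
        then show ?thesis by (simp add: algebra_simps)
      qed
      have "(\<tau> + k - 2 * \<kappa> * \<tau> * k) * (d (y (Suc n)) (z (Suc m)))\<^sup>2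
        \<le> k * (d (y n) (z (Suc m)))\<^sup>2 + \<tau> * (d (y (Suc n)) (z m))\<^sup>2"
        unfolding k_def using prox_pair_inequality[OF \<tau>0 \<tau> h(1) h\<kappa> yM zM y(2) z(2)] .
      also have "\<dots> \<le> k * (B n (Suc m) * ((A n)\<^sup>2 * (P (Suc m))\<^sup>2 * s\<^sup>2))
          + \<tau> * (B (Suc n) m * ((A (Suc n))\<^sup>2 * (P m)\<^sup>2 * s\<^sup>2))"
        using IH1[of "Suc m"] Suc.IH k \<tau>0 by (intro add_mono mult_left_mono) auto
      also have "\<dots> = (k * ((1 - \<kappa> * \<tau>)\<^sup>2 * (b - 2 * c * \<tau>)) + \<tau> * ((1 - \<kappa> * k)\<^sup>2 * (b + 2 * c * k))) * Q"
        unfolding A P b1 b2 Q_def by algebra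
      also have "\<dots> \<le> ((\<tau> + k - 2 * \<kappa> * \<tau> * k) * b) * Q"
        using k kappa_nonneg \<tau> B0[of "Suc n" "Suc m"] B0[of n "Suc m"] Q0
        by (intro mult_right_mono kobayashi_weight_step) (auto simp: b_def[symmetric] b1)
      also have "\<dots> = (\<tau> + k - 2 * \<kappa> * \<tau> * k) * (b * Q)" by (simp only: mult.assoc)
      finally show ?case using pos by (simp add: b_def Q_def)
    qed
  qed
  then show ?thesis by (simp add: A_def B_def P_def S_def T_def mult.assoc)
qed

end

section \<open>Couplings and plans\<close>

text \<open>Any two random variables on one probability space have a coupling as joint law. Upper
  bounds on \<open>W2sq\<close> thus reduce to constructing variables, without handling couplings
  again.\<close>

lemma W2sq_le_random_variables:
  fixes X Y :: "'b \<Rightarrow> 'a::euclidean_space"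
  assumes M: "prob_space M" and [measurable]: "X \<in> borel_measurable M" "Y \<in> borel_measurable M"
  shows "W2sq (distr M borel X) (distr M borel Y) \<le> (\<integral>\<^sup>+ \<omega>. ennreal ((dist (X \<omega>) (Y \<omega>))\<^sup>2) \<partial>M)"
proof -
  let ?\<gamma> = "distr M borel (\<lambda>\<omega>. (X \<omega>, Y \<omega>))"
  have [measurable]: "(\<lambda>\<omega>. (X \<omega>, Y \<omega>)) \<in> M \<rightarrow>\<^sub>M borel"
    unfolding borel_prod[symmetric] by measurable
  have fs [measurable]: "fst \<in> borel \<rightarrow>\<^sub>M (borel :: 'a measure)" "snd \<in> borel \<rightarrow>\<^sub>M (borel :: 'a measure)"
    by (auto intro!: borel_measurable_continuous_onI continuous_intros)
  have "?\<gamma> \<in> couplings (distr M borel X) (distr M borel Y)"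
    using prob_space.prob_space_distr[OF M, of "\<lambda>\<omega>. (X \<omega>, Y \<omega>)" borel]
    by (auto simp: couplings_def distr_distr comp_def)
  then have "W2sq (distr M borel X) (distr M borel Y) \<le> cost ?\<gamma>"
    unfolding W2sq_def by (rule INF_lower)
  also have "cost ?\<gamma> = (\<integral>\<^sup>+ \<omega>. ennreal ((dist (X \<omega>) (Y \<omega>))\<^sup>2) \<partial>M)"
    unfolding cost_def by (subst nn_integral_distr) auto
  finally show ?thesis .
qed

lemma couplings_measurable:
  assumes "\<gamma> \<in> couplings \<mu> (\<nu> :: 'a::euclidean_space measure)"
  shows "fst \<in> borel_measurable \<gamma>" "snd \<in> borel_measurable \<gamma>"
  using assms by (auto simp: couplings_def intro!: borel_measurable_continuous_onI continuous_intros
      cong: measurable_cong_sets)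

lemma W2sq_commute: "W2sq \<mu> \<nu> = W2sq \<nu> (\<mu> :: 'a::euclidean_space measure)"
proof -
  have "W2sq \<nu> \<mu> \<le> W2sq \<mu> \<nu>" for \<mu> \<nu> :: "'a measure"
    unfolding W2sq_def[of \<mu> \<nu>]
  proof (rule INF_greatest)
    fix \<gamma> assume \<gamma>: "\<gamma> \<in> couplings \<mu> \<nu>"
    then show "W2sq \<nu> \<mu> \<le> cost \<gamma>"
      using W2sq_le_random_variables[of \<gamma> snd fst] couplings_measurable[OF \<gamma>]
      by (simp add: couplings_def cost_def dist_commute)
  qed
  then show ?thesis by (meson antisym)
qed

lemma W2_commute: "W2 \<mu> \<nu> = W2 \<nu> \<mu>"
  by (simp add: W2_def W2sq_commute)

lemma W2_nonneg: "0 \<le> W2 \<mu> \<nu>"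
  by (simp add: W2_def)

lemma distr_id_Prob: "\<mu> \<in> Prob \<Longrightarrow> distr \<mu> borel (\<lambda>x. x) = \<mu>"
  by (auto simp: Prob_def intro: distr_id2)

lemma W2sq_self: "\<mu> \<in> Prob \<Longrightarrow> W2sq \<mu> \<mu> = 0"
  using W2sq_le_random_variables[of \<mu> "\<lambda>x. x" "\<lambda>x. x"] distr_id_Prob[of \<mu>]
  by (simp add: Prob_def measurable_ident_sets)

lemma coupling_cost_0_imp_eq:
  assumes \<gamma>: "\<gamma> \<in> couplings \<mu> \<nu>" and "cost \<gamma> = 0"
  shows "\<mu> = \<nu>"
proof -
  note [measurable] = couplings_measurable[OF \<gamma>]
  have "AE p in \<gamma>. ennreal ((dist (fst p) (snd p))\<^sup>2) = 0"
    using assms(2) unfolding cost_def by (subst (asm) nn_integral_0_iff_AE) auto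
  then have "AE p in \<gamma>. fst p = snd p" by eventually_elim (simp add: ennreal_eq_0_iff)
  then have "distr \<gamma> borel fst = distr \<gamma> borel snd" by (intro distr_cong_AE) auto
  then show ?thesis using \<gamma> unfolding couplings_def by auto
qed

text \<open>This replaces Minkowski's inequality: the optimal \<open>t\<close> is
  \<open>B / A\<close>. Either number may vanish, so both are enlarged by \<open>e\<close> first and
  \<open>e\<close> then tends to 0.\<close>

lemma le_square_sum_if_young:
  fixes v A B :: real
  assumes "0 \<le> A" "0 \<le> B" and young: "\<And>t. 0 < t \<Longrightarrow> v \<le> (1 + t) * A\<^sup>2 + (1 + 1 / t) * B\<^sup>2"
  shows "v \<le> (A + B)\<^sup>2"
proof (rule tendsto_lowerbound)
  show "((\<lambda>e. (A + e + (B + e))\<^sup>2) \<longlongrightarrow> (A + B)\<^sup>2) (at_right 0)"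
    by (rule tendsto_eq_intros refl | simp)+
  show "\<forall>\<^sub>F e in at_right 0. v \<le> (A + e + (B + e))\<^sup>2"
  proof (rule eventually_at_rightI[of 0 1])
    fix e :: real assume "e \<in> {0<..<1}"
    then have e: "0 < e" by simp
    define a b where "a = A + e" and "b = B + e"
    have ab: "0 < a" "0 < b" "A\<^sup>2 \<le> a\<^sup>2" "B\<^sup>2 \<le> b\<^sup>2"
      using assms e by (auto simp: a_def b_def intro!: power_mono)
    have "v \<le> (1 + b / a) * A\<^sup>2 + (1 + 1 / (b / a)) * B\<^sup>2" using ab by (intro young) simp
    also have "\<dots> \<le> (1 + b / a) * a\<^sup>2 + (1 + 1 / (b / a)) * b\<^sup>2"
      using ab by (intro add_mono mult_left_mono) auto
    also have "\<dots> = (a + b)\<^sup>2" using ab by (simp add: field_simps power2_eq_square)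
    finally show "v \<le> (A + e + (B + e))\<^sup>2" by (simp add: a_def b_def)
  qed simp
qed simp

lemma dist_square_young:
  fixes x y z :: "'a::metric_space"
  assumes "0 < t"
  shows "(dist y z)\<^sup>2 \<le> (1 + t) * (dist x y)\<^sup>2 + (1 + 1 / t) * (dist x z)\<^sup>2"
proof -
  define a b where "a = dist x y" and "b = dist x z"
  have "(dist y z)\<^sup>2 \<le> (a + b)\<^sup>2"
    unfolding a_def b_def by (intro power_mono) (auto intro: dist_triangle3 simp: dist_commute)
  also have "(a + b)\<^sup>2 = (1 + t) * a\<^sup>2 + (1 + 1 / t) * b\<^sup>2 - (t * a - b)\<^sup>2 / t"
    using assms by (simp add: field_simps power2_eq_square)
  also have "\<dots> \<le> (1 + t) * a\<^sup>2 + (1 + 1 / t) * b\<^sup>2" using assms by simp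
  finally show ?thesis by (simp add: a_def b_def)
qed

text \<open>An identity, expressing that the space is flat. Integrated against a plan it yields the
  convexity of the squared distance from the base, with the plan cost as modulus.\<close>

lemma dist_square_convex_comb:
  fixes x y z :: "'a::real_inner"
  shows "(dist x ((1 - t) *\<^sub>R y + t *\<^sub>R z))\<^sup>2 + t * (1 - t) * (dist y z)\<^sup>2
    = (1 - t) * (dist x y)\<^sup>2 + t * (dist x z)\<^sup>2"
proof -
  define a b where "a = x - y" and "b = x - z"
  have "x - ((1 - t) *\<^sub>R y + t *\<^sub>R z) = (1 - t) *\<^sub>R a + t *\<^sub>R b" "y - z = b - a"
    by (auto simp: a_def b_def algebra_simps)
  moreover have "((1 - t) *\<^sub>R a + t *\<^sub>R b) \<bullet> ((1 - t) *\<^sub>R a + t *\<^sub>R b) + t * (1 - t) * ((b - a) \<bullet> (b - a))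
    = (1 - t) * (a \<bullet> a) + t * (b \<bullet> b)"
    unfolding inner_diff_left inner_diff_right inner_add_left inner_add_right inner_scaleR_left
      inner_scaleR_right inner_commute[of b a]
    by algebra
  ultimately show ?thesis
    unfolding dist_norm power2_norm_eq_inner by (simp add: a_def b_def)
qed

section \<open>Three-point plans: marginals, costs and interpolated measures\<close>

locale plan =
  fixes w :: "('a::euclidean_space \<times> 'a \<times> 'a) measure" and \<omega> \<mu>0 \<mu>1 :: "'a measure"
  assumes plan: "w \<in> plans \<omega> \<mu>0 \<mu>1"
begin

sublocale prob_space w
  using plan by (simp add: plans_def)

lemma sets_w [measurable_cong]: "sets w = sets borel"
  using plan by (simp add: plans_def)

lemma coordinates [measurable]:
  "(\<lambda>(x1, x2, x3). x1) \<in> borel_measurable w"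
  "(\<lambda>(x1, x2, x3). x2) \<in> borel_measurable w"
  "(\<lambda>(x1, x2, x3). x3) \<in> borel_measurable w"
  unfolding split_beta' measurable_cong_sets[OF sets_w refl]
  by (intro borel_measurable_continuous_onI continuous_intros)+

lemma pair_projections:
  "(\<lambda>(x1, x2, x3). (x1, x2)) \<in> w \<rightarrow>\<^sub>M borel" "(\<lambda>(x1, x2, x3). (x1, x3)) \<in> w \<rightarrow>\<^sub>M borel"
  unfolding split_beta' measurable_cong_sets[OF sets_w refl]
  by (intro borel_measurable_continuous_onI continuous_intros)+

lemma proj_couplings:
  "distr w borel (\<lambda>(x1, x2, x3). (x1, x2)) \<in> opt_couplings \<omega> \<mu>0"
  "distr w borel (\<lambda>(x1, x2, x3). (x1, x3)) \<in> opt_couplings \<omega> \<mu>1"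
  using plan by (simp_all add: plans_def)

lemma marginals:
  "distr w borel (\<lambda>(x1, x2, x3). x1) = \<omega>"
  "distr w borel (\<lambda>(x1, x2, x3). x2) = \<mu>0"
  "distr w borel (\<lambda>(x1, x2, x3). x3) = \<mu>1"
proof -
  have [measurable]: "fst \<in> borel \<rightarrow>\<^sub>M (borel :: 'a measure)" "snd \<in> borel \<rightarrow>\<^sub>M (borel :: 'a measure)"
    by (auto intro!: borel_measurable_continuous_onI continuous_intros)
  have "distr (distr w borel (\<lambda>(x1, x2, x3). (x1, x2))) borel fst = distr w borel (\<lambda>(x1, x2, x3). x1)"
    "distr (distr w borel (\<lambda>(x1, x2, x3). (x1, x2))) borel snd = distr w borel (\<lambda>(x1, x2, x3). x2)"
    "distr (distr w borel (\<lambda>(x1, x2, x3). (x1, x3))) borel snd = distr w borel (\<lambda>(x1, x2, x3). x3)"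
    by (subst distr_distr[OF _ pair_projections(1)] distr_distr[OF _ pair_projections(2)],
        simp, simp add: comp_def split_beta')+
  then show "distr w borel (\<lambda>(x1, x2, x3). x1) = \<omega>" "distr w borel (\<lambda>(x1, x2, x3). x2) = \<mu>0"
    "distr w borel (\<lambda>(x1, x2, x3). x3) = \<mu>1"
    using proj_couplings by (simp_all add: opt_couplings_def couplings_def)
qed

lemma base_costs:
  "(\<integral>\<^sup>+ (x1, x2, x3). ennreal ((dist x1 x2)\<^sup>2) \<partial>w) = W2sq \<omega> \<mu>0"
  "(\<integral>\<^sup>+ (x1, x2, x3). ennreal ((dist x1 x3)\<^sup>2) \<partial>w) = W2sq \<omega> \<mu>1"
proof -
  have [measurable]: "fst \<in> borel \<rightarrow>\<^sub>M (borel :: 'a measure)" "snd \<in> borel \<rightarrow>\<^sub>M (borel :: 'a measure)"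
    by (auto intro!: borel_measurable_continuous_onI continuous_intros)
  have "cost (distr w borel (\<lambda>(x1, x2, x3). (x1, x2))) = (\<integral>\<^sup>+ (x1, x2, x3). ennreal ((dist x1 x2)\<^sup>2) \<partial>w)"
    unfolding cost_def by (subst nn_integral_distr[OF pair_projections(1)]) (simp_all add: split_beta')
  moreover have "cost (distr w borel (\<lambda>(x1, x2, x3). (x1, x3))) = (\<integral>\<^sup>+ (x1, x2, x3). ennreal ((dist x1 x3)\<^sup>2) \<partial>w)"
    unfolding cost_def by (subst nn_integral_distr[OF pair_projections(2)]) (simp_all add: split_beta')
  ultimately show "(\<integral>\<^sup>+ (x1, x2, x3). ennreal ((dist x1 x2)\<^sup>2) \<partial>w) = W2sq \<omega> \<mu>0"
    "(\<integral>\<^sup>+ (x1, x2, x3). ennreal ((dist x1 x3)\<^sup>2) \<partial>w) = W2sq \<omega> \<mu>1"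
    using proj_couplings by (simp_all add: opt_couplings_def)
qed

lemma W2sq_le_plan: "W2sq \<mu>0 \<mu>1 \<le> W2_plan_sq w"
  using W2sq_le_random_variables[OF prob_space_axioms coordinates(2,3)] marginals
  by (simp add: W2_plan_sq_def split_beta')

lemma W2_plan_sq_le:
  assumes t: "0 < t"
  shows "W2_plan_sq w \<le> ennreal (1 + t) * W2sq \<omega> \<mu>0 + ennreal (1 + 1 / t) * W2sq \<omega> \<mu>1"
proof -
  note [measurable] = coordinates[unfolded split_beta']
  have "W2_plan_sq w \<le> (\<integral>\<^sup>+ (x1, x2, x3). ennreal (1 + t) * ennreal ((dist x1 x2)\<^sup>2)
      + ennreal (1 + 1 / t) * ennreal ((dist x1 x3)\<^sup>2) \<partial>w)"
    unfolding W2_plan_sq_def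
  proof (rule nn_integral_mono, clarify)
    fix x1 x2 x3 :: 'a
    show "ennreal ((dist x2 x3)\<^sup>2) \<le> ennreal (1 + t) * ennreal ((dist x1 x2)\<^sup>2)
      + ennreal (1 + 1 / t) * ennreal ((dist x1 x3)\<^sup>2)"
      using dist_square_young[OF t, of x2 x3 x1] t
      by (simp add: ennreal_mult[symmetric] ennreal_plus[symmetric] ennreal_leI del: ennreal_plus)
  qed
  also have "\<dots> = ennreal (1 + t) * W2sq \<omega> \<mu>0 + ennreal (1 + 1 / t) * W2sq \<omega> \<mu>1"
    unfolding base_costs[symmetric] split_beta'
    by (subst nn_integral_add) (auto simp: nn_integral_cmult)
  finally show ?thesis .
qed

text \<open>The plan cost is added on the left instead of subtracted on the right, since subtraction
  of extended nonnegative numbers truncates; the real form follows once finiteness is known.\<close>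

lemma W2sq_gen_geod:
  assumes \<alpha>: "\<alpha> \<in> {0..1}"
  shows "W2sq \<omega> (gen_geod w \<alpha>) + ennreal (\<alpha> * (1 - \<alpha>)) * W2_plan_sq w
    \<le> ennreal (1 - \<alpha>) * W2sq \<omega> \<mu>0 + ennreal \<alpha> * W2sq \<omega> \<mu>1"
proof -
  note [measurable] = coordinates[unfolded split_beta']
  have "W2sq \<omega> (gen_geod w \<alpha>)
    \<le> (\<integral>\<^sup>+ (x1, x2, x3). ennreal ((dist x1 ((1 - \<alpha>) *\<^sub>R x2 + \<alpha> *\<^sub>R x3))\<^sup>2) \<partial>w)"
    using W2sq_le_random_variables[OF prob_space_axioms, of "\<lambda>(x1, x2, x3). x1"
        "\<lambda>(x1, x2, x3). (1 - \<alpha>) *\<^sub>R x2 + \<alpha> *\<^sub>R x3"] marginals(1)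
    by (simp add: gen_geod_def split_beta')
  then have "W2sq \<omega> (gen_geod w \<alpha>) + ennreal (\<alpha> * (1 - \<alpha>)) * W2_plan_sq w
    \<le> (\<integral>\<^sup>+ (x1, x2, x3). ennreal ((dist x1 ((1 - \<alpha>) *\<^sub>R x2 + \<alpha> *\<^sub>R x3))\<^sup>2) \<partial>w)
      + ennreal (\<alpha> * (1 - \<alpha>)) * W2_plan_sq w"
    by (rule add_right_mono)
  also have "\<dots> = (\<integral>\<^sup>+ (x1, x2, x3). ennreal ((dist x1 ((1 - \<alpha>) *\<^sub>R x2 + \<alpha> *\<^sub>R x3))\<^sup>2)
      + ennreal (\<alpha> * (1 - \<alpha>)) * ennreal ((dist x2 x3)\<^sup>2) \<partial>w)"
    unfolding W2_plan_sq_def split_beta' by (subst nn_integral_add) (auto simp: nn_integral_cmult)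
  also have "\<dots> = (\<integral>\<^sup>+ (x1, x2, x3). ennreal (1 - \<alpha>) * ennreal ((dist x1 x2)\<^sup>2)
      + ennreal \<alpha> * ennreal ((dist x1 x3)\<^sup>2) \<partial>w)"
  proof (rule nn_integral_cong, clarify)
    fix x1 x2 x3 :: 'a
    show "ennreal ((dist x1 ((1 - \<alpha>) *\<^sub>R x2 + \<alpha> *\<^sub>R x3))\<^sup>2)
        + ennreal (\<alpha> * (1 - \<alpha>)) * ennreal ((dist x2 x3)\<^sup>2)
      = ennreal (1 - \<alpha>) * ennreal ((dist x1 x2)\<^sup>2) + ennreal \<alpha> * ennreal ((dist x1 x3)\<^sup>2)"
      using dist_square_convex_comb[of x1 \<alpha> x2 x3] \<alpha>
      by (simp add: ennreal_mult[symmetric] ennreal_plus[symmetric] del: ennreal_plus)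
  qed
  also have "\<dots> = ennreal (1 - \<alpha>) * W2sq \<omega> \<mu>0 + ennreal \<alpha> * W2sq \<omega> \<mu>1"
    unfolding base_costs[symmetric] split_beta'
    by (subst nn_integral_add) (auto simp: nn_integral_cmult)
  finally show ?thesis .
qed

lemma gen_geod_Prob: "gen_geod w \<alpha> \<in> Prob"
proof -
  note [measurable] = coordinates[unfolded split_beta']
  have "prob_space (gen_geod w \<alpha>)"
    unfolding gen_geod_def split_beta' by (rule prob_space_distr) measurable
  then show ?thesis by (simp add: Prob_def gen_geod_def)
qed

end

section \<open>Completeness\<close>

lemma countable_cells:
  fixes e :: real
  assumes "0 < e"
  shows "\<exists>(idx :: 'a::euclidean_space \<Rightarrow> nat) c. idx \<in> borel \<rightarrow>\<^sub>M count_space UNIV \<and> (\<forall>x. dist (c (idx x)) x < e)"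
proof -
  obtain Q :: "'a set" where Q: "countable Q" "\<And>X. open X \<Longrightarrow> X \<noteq> {} \<Longrightarrow> \<exists>d\<in>Q. d \<in> X"
    using countable_dense_setE by metis
  define c where "c = from_nat_into Q"
  \<comment> \<open>Choosing the first dense point within \<open>e\<close> makes the cells disjoint
    and the index measurable.\<close>
  define idx where "idx x = (LEAST i. dist (c i) x < e)" for x
  have "\<exists>i. dist (c i) x < e" for x
  proof -
    have "ball x e \<noteq> {}" using assms by simp
    then obtain q where "q \<in> Q" "q \<in> ball x e" using Q(2)[OF open_ball] by blast
    then show ?thesis
      using from_nat_into_surj[OF Q(1)] by (metis c_def dist_commute mem_ball)
  qed
  then have "dist (c (idx x)) x < e" for x unfolding idx_def by (rule LeastI_ex)
  moreover have "idx \<in> borel \<rightarrow>\<^sub>M count_space UNIV" unfolding idx_def by measurable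
  ultimately show ?thesis by blast
qed

lemma nn_integral_split_nat:
  assumes [measurable]: "i \<in> M \<rightarrow>\<^sub>M count_space UNIV" "\<And>k::nat. G k \<in> borel_measurable M"
  shows "(\<integral>\<^sup>+ x. G (i x) x \<partial>M) = (\<Sum>k. \<integral>\<^sup>+ x. G k x * indicator (i -` {k} \<inter> space M) x \<partial>M)"
proof -
  have [measurable]: "i -` {k} \<inter> space M \<in> sets M" for k
    by (rule measurable_sets[OF assms(1)]) simp
  have "(\<integral>\<^sup>+ x. G (i x) x \<partial>M) = (\<integral>\<^sup>+ x. (\<Sum>k. G k x * indicator (i -` {k} \<inter> space M) x) \<partial>M)"
  proof (rule nn_integral_cong)
    fix x assume x: "x \<in> space M"
    have "(\<Sum>k. G k x * indicator (i -` {k} \<inter> space M) x) = (\<Sum>k\<in>{i x}. G k x * indicator (i -` {k} \<inter> space M) x)"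
      by (rule suminf_finite) (auto simp: indicator_def)
    then show "G (i x) x = (\<Sum>k. G k x * indicator (i -` {k} \<inter> space M) x)" using x by simp
  qed
  also have "\<dots> = (\<Sum>k. \<integral>\<^sup>+ x. G k x * indicator (i -` {k} \<inter> space M) x \<partial>M)"
    by (rule nn_integral_suminf) measurable
  finally show ?thesis .
qed

text \<open>Conditioning the second marginal on the cell of the first coordinate only: this elementary
  conditional law replaces a disintegration of the coupling.\<close>

lemma cellwise_kernel:
  fixes \<gamma> :: "('a::euclidean_space \<times> 'a) measure" and idx :: "'a \<Rightarrow> nat"
  assumes \<gamma>: "\<gamma> \<in> couplings \<mu> \<nu>" and idx [measurable]: "idx \<in> borel \<rightarrow>\<^sub>M count_space UNIV"
  shows "\<exists>\<kappa>. (\<forall>i. prob_space (\<kappa> i) \<and> sets (\<kappa> i) = sets borel) \<and>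
    (\<forall>F. (\<forall>i. F i \<in> borel_measurable borel) \<longrightarrow>
      (\<integral>\<^sup>+ x. (\<integral>\<^sup>+ y. F (idx x) y \<partial>\<kappa> (idx x)) \<partial>\<mu>) = (\<integral>\<^sup>+ p. F (idx (fst p)) (snd p) \<partial>\<gamma>))"
proof -
  interpret \<gamma>: prob_space \<gamma> using \<gamma> by (simp add: couplings_def)
  note [measurable] = couplings_measurable[OF \<gamma>]
  have \<mu>: "\<mu> = distr \<gamma> borel fst" and \<nu>: "\<nu> = distr \<gamma> borel snd" using \<gamma> by (auto simp: couplings_def)
  define A where "A i = (\<lambda>p. idx (fst p)) -` {i} \<inter> space \<gamma>" for i
  have A [measurable]: "A i \<in> sets \<gamma>" for i
    unfolding A_def by measurable
  \<comment> \<open>On a cell of mass zero conditioning is undefined; \<open>\<nu>\<close> serves as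
    a default there, to keep every \<open>\<kappa> i\<close> a probability measure.\<close>
  define \<kappa> where "\<kappa> i = (if emeasure \<gamma> (A i) = 0 then \<nu> else distr (uniform_measure \<gamma> (A i)) borel snd)" for i
  have U [measurable_cong]: "sets (uniform_measure \<gamma> (A i)) = sets \<gamma>" for i by simp
  have prob: "prob_space (\<kappa> i)" for i
  proof (cases "emeasure \<gamma> (A i) = 0")
    case True
    then show ?thesis by (simp add: \<kappa>_def \<nu> \<gamma>.prob_space_distr)
  next
    case False
    then have "prob_space (uniform_measure \<gamma> (A i))" by (intro prob_space_uniform_measure) auto
    then show ?thesis using False by (simp add: \<kappa>_def prob_space.prob_space_distr)
  qed
  have sets: "sets (\<kappa> i) = sets borel" for i by (simp add: \<kappa>_def \<nu>)
  have "(\<integral>\<^sup>+ x. (\<integral>\<^sup>+ y. F (idx x) y \<partial>\<kappa> (idx x)) \<partial>\<mu>) = (\<integral>\<^sup>+ p. F (idx (fst p)) (snd p) \<partial>\<gamma>)"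
    if [measurable]: "\<And>i. F i \<in> borel_measurable borel" for F :: "nat \<Rightarrow> 'a \<Rightarrow> ennreal"
  proof -
    have cell: "(\<integral>\<^sup>+ p. (\<integral>\<^sup>+ y. F i y \<partial>\<kappa> i) * indicator (A i) p \<partial>\<gamma>)
      = (\<integral>\<^sup>+ p. F i (snd p) * indicator (A i) p \<partial>\<gamma>)" for i
    proof (cases "emeasure \<gamma> (A i) = 0")
      case True
      then have "AE p in \<gamma>. p \<notin> A i" by (intro AE_not_in) (auto simp: null_sets_def)
      then have "(\<integral>\<^sup>+ p. c p * indicator (A i) p \<partial>\<gamma>) = 0" for c :: "'a \<times> 'a \<Rightarrow> ennreal"
        by (subst nn_integral_cong_AE[where v = "\<lambda>_. 0"]) auto
      then show ?thesis by simp
    next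
      case False
      then have "(\<integral>\<^sup>+ y. F i y \<partial>\<kappa> i) = (\<integral>\<^sup>+ p. F i (snd p) * indicator (A i) p \<partial>\<gamma>) / emeasure \<gamma> (A i)"
        by (simp add: \<kappa>_def nn_integral_distr nn_integral_uniform_measure)
      moreover have "(\<integral>\<^sup>+ p. c * indicator (A i) p \<partial>\<gamma>) = c * emeasure \<gamma> (A i)" for c
        by (rule nn_integral_cmult_indicator) measurable
      moreover have "c / emeasure \<gamma> (A i) * emeasure \<gamma> (A i) = c" for c
        using False by (simp add: ennreal_divide_times ennreal_divide_self less_top[symmetric])
      ultimately show ?thesis by metis
    qed
    have "(\<integral>\<^sup>+ x. (\<integral>\<^sup>+ y. F (idx x) y \<partial>\<kappa> (idx x)) \<partial>\<mu>)
      = (\<integral>\<^sup>+ p. (\<integral>\<^sup>+ y. F (idx (fst p)) y \<partial>\<kappa> (idx (fst p))) \<partial>\<gamma>)"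
      unfolding \<mu> by (rule nn_integral_distr) measurable
    also have "\<dots> = (\<Sum>i. \<integral>\<^sup>+ p. (\<integral>\<^sup>+ y. F i y \<partial>\<kappa> i) * indicator (A i) p \<partial>\<gamma>)"
      unfolding A_def by (rule nn_integral_split_nat[where G = "\<lambda>i p. \<integral>\<^sup>+ y. F i y \<partial>\<kappa> i"]) measurable
    also have "\<dots> = (\<Sum>i. \<integral>\<^sup>+ p. F i (snd p) * indicator (A i) p \<partial>\<gamma>)"
      by (simp only: cell)
    also have "\<dots> = (\<integral>\<^sup>+ p. F (idx (fst p)) (snd p) \<partial>\<gamma>)"
      unfolding A_def by (rule nn_integral_split_nat[where G = "\<lambda>i p. F i (snd p)", symmetric]) measurable
    finally show ?thesis .
  qed
  then show ?thesis using prob sets by blast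
qed

lemma dist_square_two_sided:
  fixes x y c :: "'a::metric_space"
  assumes "dist c x < e"
  shows "(dist x y)\<^sup>2 \<le> 2 * (dist c y)\<^sup>2 + 2 * e\<^sup>2" "(dist c y)\<^sup>2 \<le> 2 * (dist x y)\<^sup>2 + 2 * e\<^sup>2"
proof -
  have e: "(dist c x)\<^sup>2 \<le> e\<^sup>2" using assms by (intro power_mono) auto
  show "(dist x y)\<^sup>2 \<le> 2 * (dist c y)\<^sup>2 + 2 * e\<^sup>2"
    using dist_square_young[of 1 x y c] e by simp
  show "(dist c y)\<^sup>2 \<le> 2 * (dist x y)\<^sup>2 + 2 * e\<^sup>2"
    using dist_square_young[of 1 c y x] e by (simp add: dist_commute)
qed

text \<open>Conditioning on cells reproduces the second marginal exactly and distorts only the cost: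
  within a cell the pairing is forgotten, and passing through its center twice gives
  \<open>4 * dist\<^sup>2 + 6 * e\<^sup>2\<close>.\<close>

lemma approximate_gluing_kernel:
  fixes \<mu> \<nu> :: "'a::euclidean_space measure"
  assumes W: "W2sq \<mu> \<nu> < ennreal B"
  shows "\<exists>K. K \<in> borel \<rightarrow>\<^sub>M subprob_algebra borel \<and> (\<forall>x. prob_space (K x)) \<and>
    (\<forall>F\<in>borel_measurable borel. (\<integral>\<^sup>+ x. (\<integral>\<^sup>+ y. F y \<partial>K x) \<partial>\<mu>) = (\<integral>\<^sup>+ y. F y \<partial>\<nu>)) \<and>
    (\<integral>\<^sup>+ x. (\<integral>\<^sup>+ y. ennreal ((dist x y)\<^sup>2) \<partial>K x) \<partial>\<mu>) \<le> ennreal (10 * B)"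
proof -
  have B: "0 < B" using W by (metis ennreal_neg not_less not_less_zero)
  obtain \<gamma> where \<gamma>: "\<gamma> \<in> couplings \<mu> \<nu>" and cost: "cost \<gamma> < ennreal B"
    using W by (auto simp: W2sq_def INF_less_iff)
  interpret \<gamma>: prob_space \<gamma> using \<gamma> by (simp add: couplings_def)
  note [measurable] = couplings_measurable[OF \<gamma>]
  have \<mu>: "\<mu> = distr \<gamma> borel fst" and \<nu>: "\<nu> = distr \<gamma> borel snd" using \<gamma> by (auto simp: couplings_def)
  then have sets_\<mu> [measurable_cong]: "sets \<mu> = sets borel" by simp
  interpret \<mu>: prob_space \<mu> unfolding \<mu> by (rule \<gamma>.prob_space_distr) simp
  \<comment> \<open>With this radius the distortion is proportional to \<open>B\<close> itself, and
    \<open>4 + 6\<close> gives the factor 10.\<close>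
  define e where "e = sqrt B"
  have e: "0 < e" "e\<^sup>2 = B" using B by (auto simp: e_def)
  obtain idx :: "'a \<Rightarrow> nat" and c where idx [measurable]: "idx \<in> borel \<rightarrow>\<^sub>M count_space UNIV"
    and c: "\<And>x. dist (c (idx x)) x < e"
    using countable_cells[OF e(1)] by metis
  obtain \<kappa> where \<kappa>: "\<And>i. prob_space (\<kappa> i)" "\<And>i. sets (\<kappa> i) = sets borel"
    and law: "\<And>F. (\<And>i. F i \<in> borel_measurable borel) \<Longrightarrow>
      (\<integral>\<^sup>+ x. (\<integral>\<^sup>+ y. F (idx x) y \<partial>\<kappa> (idx x)) \<partial>\<mu>) = (\<integral>\<^sup>+ p. F (idx (fst p)) (snd p) \<partial>\<gamma>)"
    using cellwise_kernel[OF \<gamma> idx] by metis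
  have [measurable]: "\<kappa> \<in> count_space UNIV \<rightarrow>\<^sub>M subprob_algebra borel"
    using \<kappa> by (auto simp: space_subprob_algebra prob_space_imp_subprob_space)
  have K: "(\<lambda>x. \<kappa> (idx x)) \<in> borel \<rightarrow>\<^sub>M subprob_algebra borel" by measurable
  have "(\<integral>\<^sup>+ x. (\<integral>\<^sup>+ y. ennreal ((dist x y)\<^sup>2) \<partial>\<kappa> (idx x)) \<partial>\<mu>)
    \<le> (\<integral>\<^sup>+ x. (\<integral>\<^sup>+ y. ennreal (2 * (dist (c (idx x)) y)\<^sup>2 + 2 * e\<^sup>2) \<partial>\<kappa> (idx x)) \<partial>\<mu>)"
    by (intro nn_integral_mono ennreal_leI dist_square_two_sided c)
  also have "\<dots> = (\<integral>\<^sup>+ p. ennreal (2 * (dist (c (idx (fst p))) (snd p))\<^sup>2 + 2 * e\<^sup>2) \<partial>\<gamma>)"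
    by (rule law[of "\<lambda>i y. ennreal (2 * (dist (c i) y)\<^sup>2 + 2 * e\<^sup>2)"]) measurable
  also have "\<dots> \<le> (\<integral>\<^sup>+ p. 4 * ennreal ((dist (fst p) (snd p))\<^sup>2) + ennreal (6 * e\<^sup>2) \<partial>\<gamma>)"
  proof (rule nn_integral_mono)
    fix p :: "'a \<times> 'a"
    have "2 * (dist (c (idx (fst p))) (snd p))\<^sup>2 + 2 * e\<^sup>2 \<le> 4 * (dist (fst p) (snd p))\<^sup>2 + 6 * e\<^sup>2"
      using dist_square_two_sided(2)[OF c, of "fst p" "snd p"] by linarith
    then have "ennreal (2 * (dist (c (idx (fst p))) (snd p))\<^sup>2 + 2 * e\<^sup>2)
      \<le> ennreal (4 * (dist (fst p) (snd p))\<^sup>2 + 6 * e\<^sup>2)" by (rule ennreal_leI)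
    also have "\<dots> = 4 * ennreal ((dist (fst p) (snd p))\<^sup>2) + ennreal (6 * e\<^sup>2)"
      by (simp add: ennreal_mult)
    finally show "ennreal (2 * (dist (c (idx (fst p))) (snd p))\<^sup>2 + 2 * e\<^sup>2)
      \<le> 4 * ennreal ((dist (fst p) (snd p))\<^sup>2) + ennreal (6 * e\<^sup>2)" .
  qed
  also have "\<dots> = 4 * cost \<gamma> + ennreal (6 * e\<^sup>2)"
    unfolding cost_def by (simp add: nn_integral_add nn_integral_cmult \<gamma>.emeasure_space_1)
  also have "\<dots> \<le> 4 * ennreal B + ennreal (6 * B)"
    using cost e by (intro add_mono mult_left_mono) auto
  also have "\<dots> = ennreal (10 * B)"
    using B by (simp add: ennreal_mult distrib_right[symmetric])
  finally have "(\<integral>\<^sup>+ x. (\<integral>\<^sup>+ y. ennreal ((dist x y)\<^sup>2) \<partial>\<kappa> (idx x)) \<partial>\<mu>) \<le> ennreal (10 * B)" .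
  moreover have "(\<integral>\<^sup>+ x. (\<integral>\<^sup>+ y. F y \<partial>\<kappa> (idx x)) \<partial>\<mu>) = (\<integral>\<^sup>+ y. F y \<partial>\<nu>)"
    if F [measurable]: "F \<in> borel_measurable borel" for F
    using law[of "\<lambda>_. F"] by (simp add: \<nu> nn_integral_distr)
  ultimately show ?thesis using K \<kappa> by blast
qed

section \<open>Realizing a chain of measures on one sequence space\<close>

lemma Ionescu_Tulcea_CI_eq_C:
  assumes "Ionescu_Tulcea P M"
  shows "Ionescu_Tulcea.CI P M {0..<n} = Ionescu_Tulcea.C P M 0 n (\<lambda>_. undefined)"
proof -
  interpret Ionescu_Tulcea P M by fact
  show ?thesis
  proof (rule measure_eqI)
    show "sets (CI {0..<n}) = sets (C 0 n (\<lambda>_. undefined))"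
      by (simp add: CI_def sets_C space_PiM)
    fix X assume "X \<in> sets (CI {0..<n})"
    then have X: "X \<in> sets (PiM {0..<n} M)" by (simp add: CI_def)
    \<comment> \<open>Over the full initial segment the cylinder over \<open>X\<close> is
      \<open>X\<close> itself, so no coordinates are projected away.\<close>
    then have "prod_emb {0..<n} M {0..<n} X = X" 
      using sets.sets_into_space[OF X] by (intro prod_emb_id) (simp add: space_PiM)
    then show "emeasure (CI {0..<n}) X = emeasure (C 0 n (\<lambda>_. undefined)) X"
      using emeasure_CI[OF order_refl X] by simp
  qed
qed

lemma emeasure_distr_nn_integral:
  assumes [measurable]: "X \<in> M \<rightarrow>\<^sub>M N" "A \<in> sets N"
  shows "emeasure (distr M N X) A = (\<integral>\<^sup>+ \<omega>. indicator A (X \<omega>) \<partial>M)"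
  using nn_integral_distr[of X M N "indicator A"] by simp

text \<open>Countably many kernels are composed at once by the Ionescu-Tulcea theorem. The Markov
  property appears only as an integral identity for consecutive coordinates, enough to compute
  one-dimensional laws and step costs.\<close>

lemma markov_process_exists:
  fixes \<mu>0 :: "'a::euclidean_space measure" and K :: "nat \<Rightarrow> 'a \<Rightarrow> 'a measure"
  assumes \<mu>0: "prob_space \<mu>0" "sets \<mu>0 = sets borel"
    and K [measurable]: "\<And>n. K n \<in> borel \<rightarrow>\<^sub>M subprob_algebra borel" and prob_K: "\<And>n x. prob_space (K n x)"
  shows "\<exists>L. prob_space L \<and> sets L = sets (PiM UNIV (\<lambda>_. borel)) \<and> distr L borel (\<lambda>\<omega>. \<omega> 0) = \<mu>0 \<and>
    (\<forall>n g. case_prod g \<in> borel_measurable (borel \<Otimes>\<^sub>M borel) \<longrightarrow>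
      (\<integral>\<^sup>+ \<omega>. g (\<omega> n) (\<omega> (Suc n)) \<partial>L) = (\<integral>\<^sup>+ \<omega>. (\<integral>\<^sup>+ y. g (\<omega> n) y \<partial>K n (\<omega> n)) \<partial>L))"
proof -
  \<comment> \<open>Stage 0 draws from the initial law, so the kernel \<open>K n\<close> drives
    stage \<open>Suc n\<close> and sees the past only through coordinate \<open>n\<close>.\<close>
  define P where "P i x = (case i of 0 \<Rightarrow> \<mu>0 | Suc n \<Rightarrow> K n (x n))" for i and x :: "nat \<Rightarrow> 'a"
  let ?M = "\<lambda>_::nat. borel :: 'a measure"
  have IT: "Ionescu_Tulcea P ?M"
  proof (rule Ionescu_Tulcea.intro)
    fix i
    show "P i \<in> PiM {0..<i} ?M \<rightarrow>\<^sub>M subprob_algebra borel"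
    proof (cases i)
      case 0
      have "P 0 = (\<lambda>_. \<mu>0)" by (simp add: P_def fun_eq_iff)
      then show ?thesis
        using \<mu>0 0 by (auto simp: space_subprob_algebra prob_space_imp_subprob_space intro!: measurable_const)
    next
      case (Suc n)
      have [measurable]: "(\<lambda>x. x n) \<in> PiM {0..<i} ?M \<rightarrow>\<^sub>M borel"
        using Suc by (intro measurable_component_singleton) auto
      have "(\<lambda>x. K n (x n)) \<in> PiM {0..<i} ?M \<rightarrow>\<^sub>M subprob_algebra borel" by measurable
      then show ?thesis using Suc by (simp add: P_def[abs_def])
    qed
  next
    fix i and x :: "nat \<Rightarrow> 'a" show "prob_space (P i x)" using \<mu>0 prob_K by (cases i) (auto simp: P_def)
  qed
  interpret Ionescu_Tulcea P ?M by (rule IT)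
  define L where "L = PF.lim"
  \<comment> \<open>The empty history: the only point of the product over no coordinates.\<close>
  define u where "u = (\<lambda>_::nat. undefined :: 'a)"
  have sets_L [measurable_cong]: "sets L = sets (PiM UNIV ?M)" by (simp add: L_def)
  have restr [measurable]: "(\<lambda>\<omega>. restrict \<omega> {0..<n}) \<in> L \<rightarrow>\<^sub>M PiM {0..<n} ?M" for n
    unfolding measurable_cong_sets[OF sets_L refl] by (rule measurable_restrict_subset) simp
  have C_distr: "C 0 n u = distr L (PiM {0..<n} ?M) (\<lambda>\<omega>. restrict \<omega> {0..<n})" for n
    unfolding L_def u_def using distr_lim[of "{0..<n}"] Ionescu_Tulcea_CI_eq_C[OF IT] by simp
  have finite_dim: "(\<integral>\<^sup>+ \<omega>. f (restrict \<omega> {0..<n}) \<partial>L) = (\<integral>\<^sup>+ x. f x \<partial>C 0 n u)"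
    if [measurable]: "f \<in> borel_measurable (PiM {0..<n} ?M)" for n f
    unfolding C_distr by (simp add: nn_integral_distr)
  have u: "u \<in> space (PiM {0..<0} ?M)" by (simp add: u_def space_PiM)
  have prob_L: "prob_space L"
    using prob_space_C[OF u, of 0] unfolding add_0 C_distr by (rule prob_space_distrD[OF restr])
  have C_step: "(\<integral>\<^sup>+ x. f x \<partial>C 0 (Suc n) u) = (\<integral>\<^sup>+ x. (\<integral>\<^sup>+ y. f (x(n := y)) \<partial>P n x) \<partial>C 0 n u)"
    if [measurable]: "f \<in> borel_measurable (PiM {0..<Suc n} ?M)" for n f
  proof -
    have "(\<integral>\<^sup>+ x. f x \<partial>C 0 (Suc n) u) = (\<integral>\<^sup>+ x. (\<integral>\<^sup>+ y. f y \<partial>eP n x) \<partial>C 0 n u)"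
      using measurable_eP[of n] u
      by (simp add: nn_integral_bind[where B = "PiM {0..<Suc n} ?M"] measurable_cong_sets[OF sets_C[OF u, of n] refl])
    also have "\<dots> = (\<integral>\<^sup>+ x. (\<integral>\<^sup>+ y. f (x(n := y)) \<partial>P n x) \<partial>C 0 n u)"
      using u by (intro nn_integral_cong nn_integral_eP) (auto simp: space_C)
    finally show ?thesis .
  qed
  have step: "(\<integral>\<^sup>+ \<omega>. g (\<omega> n) (\<omega> (Suc n)) \<partial>L) = (\<integral>\<^sup>+ \<omega>. (\<integral>\<^sup>+ y. g (\<omega> n) y \<partial>K n (\<omega> n)) \<partial>L)"
    if g: "case_prod g \<in> borel_measurable (borel \<Otimes>\<^sub>M borel)" for n g
  proof -
    have meas: "(\<lambda>x. g (x n) (x (Suc n))) \<in> borel_measurable (PiM {0..<Suc (Suc n)} ?M)"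
      using measurable_compose[OF _ g, of "\<lambda>x. (x n, x (Suc n))"] by simp
    have [measurable]: "(\<lambda>x. \<integral>\<^sup>+ y. g x y \<partial>K n x) \<in> borel_measurable borel"
      by (rule nn_integral_measurable_subprob_algebra2[OF g K])
    have meas': "(\<lambda>x. \<integral>\<^sup>+ y. g (x n) y \<partial>K n (x n)) \<in> borel_measurable (PiM {0..<Suc n} ?M)"
      by measurable
    have "(\<integral>\<^sup>+ \<omega>. g (\<omega> n) (\<omega> (Suc n)) \<partial>L) = (\<integral>\<^sup>+ x. g (x n) (x (Suc n)) \<partial>C 0 (Suc (Suc n)) u)"
      using finite_dim[OF meas] by simp
    also have "\<dots> = (\<integral>\<^sup>+ x. (\<integral>\<^sup>+ y. g (x n) y \<partial>K n (x n)) \<partial>C 0 (Suc n) u)"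
      using C_step[OF meas] by (simp add: P_def)
    also have "\<dots> = (\<integral>\<^sup>+ \<omega>. (\<integral>\<^sup>+ y. g (\<omega> n) y \<partial>K n (\<omega> n)) \<partial>L)"
      using finite_dim[OF meas'] by simp
    finally show ?thesis .
  qed
  have [measurable]: "(\<lambda>\<omega>. \<omega> 0) \<in> borel_measurable L" by measurable
  have "distr L borel (\<lambda>\<omega>. \<omega> 0) = \<mu>0"
  proof (rule measure_eqI)
    fix X assume "X \<in> sets (distr L borel (\<lambda>\<omega>. \<omega> 0))"
    then have X [measurable]: "X \<in> sets borel" by simp
    have meas: "(\<lambda>x. indicator X (x 0)) \<in> borel_measurable (PiM {0..<Suc 0} ?M)" by measurable
    have "emeasure (distr L borel (\<lambda>\<omega>. \<omega> 0)) X = (\<integral>\<^sup>+ \<omega>. indicator X (\<omega> 0) \<partial>L)"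
      by (rule emeasure_distr_nn_integral) measurable
    also have "\<dots> = (\<integral>\<^sup>+ x. indicator X (x 0) \<partial>C 0 (Suc 0) u)" using finite_dim[OF meas] by simp
    also have "\<dots> = (\<integral>\<^sup>+ x. (\<integral>\<^sup>+ y. indicator X y \<partial>\<mu>0) \<partial>C 0 0 u)" using C_step[OF meas] by (simp add: P_def)
    also have "\<dots> = emeasure \<mu>0 X"
      using prob_space.emeasure_space_1[OF prob_space_C[OF u, of 0]] \<mu>0 X by (simp add: nn_integral_return)
    finally show "emeasure (distr L borel (\<lambda>\<omega>. \<omega> 0)) X = emeasure \<mu>0 X" .
  qed (simp add: \<mu>0)
  then show ?thesis using prob_L sets_L step by blast
qed

text \<open>The hypothesis bounds step \<open>n\<close> by \<open>sqrt Z / 2 ^ n\<close>. The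
  geometric tail from \<open>N\<close> is \<open>2 * sqrt Z / 2 ^ N\<close>, and squaring gives the
  constant 4.\<close>

lemma dist_lim_le_if_weighted_squares_le:
  fixes x :: "nat \<Rightarrow> 'a::banach"
  assumes Z: "\<And>n. 4 ^ n * (dist (x n) (x (Suc n)))\<^sup>2 \<le> Z"
  shows "(dist (x N) (lim x))\<^sup>2 \<le> 4 * Z / 4 ^ N"
proof -
  have Z0: "0 \<le> Z" using Z[of 0] by (rule order_trans[rotated]) simp
  define q where "q = sqrt Z"
  have step: "dist (x n) (x (Suc n)) \<le> q / 2 ^ n" for n
  proof (rule power2_le_imp_le)
    have "(dist (x n) (x (Suc n)))\<^sup>2 \<le> Z / 4 ^ n" using Z[of n] by (simp add: field_simps)
    also have "\<dots> = (q / 2 ^ n)\<^sup>2"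
      using Z0 by (simp add: q_def power_divide power_mult[symmetric] mult.commute[of _ 2] power_mult)
    finally show "(dist (x n) (x (Suc n)))\<^sup>2 \<le> (q / 2 ^ n)\<^sup>2" .
    show "0 \<le> q / 2 ^ n" using Z0 by (simp add: q_def)
  qed
  have q0: "0 \<le> q" using Z0 by (simp add: q_def)
  \<comment> \<open>The bound telescopes, since
    \<open>q / 2 ^ n = 2 * q / 2 ^ n - 2 * q / 2 ^ Suc n\<close>.\<close>
  have tail: "dist (x N) (x (N + k)) \<le> 2 * q / 2 ^ N - 2 * q / 2 ^ (N + k)" for N k
  proof (induction k)
    case (Suc k)
    have "dist (x N) (x (N + Suc k)) \<le> dist (x N) (x (N + k)) + dist (x (N + k)) (x (Suc (N + k)))"
      using dist_triangle by simp
    also have "\<dots> \<le> 2 * q / 2 ^ N - 2 * q / 2 ^ (N + k) + q / 2 ^ (N + k)"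
      by (intro add_mono Suc step)
    also have "\<dots> = 2 * q / 2 ^ N - 2 * q / 2 ^ (N + Suc k)" by (simp add: field_simps)
    finally show ?case .
  qed simp
  have bound: "dist (x N) (x m) \<le> 2 * q / 2 ^ N" if "N \<le> m" for N m
  proof -
    have "0 \<le> 2 * q / 2 ^ m" using q0 by simp
    then show ?thesis using tail[of N "m - N"] that by simp
  qed
  have "(\<lambda>N. 2 * q * (1 / 2) ^ N) \<longlonglongrightarrow> 2 * q * 0" by (intro tendsto_intros LIMSEQ_power_zero) simp
  then have to0: "(\<lambda>N. 2 * q / 2 ^ N) \<longlonglongrightarrow> 0" by (simp add: power_one_over field_simps)
  have "Cauchy x"
  proof (rule metric_CauchyI)
    fix e :: real assume "0 < e"
    then have "\<forall>\<^sub>F N in sequentially. 2 * q / 2 ^ N < e / 2" by (intro order_tendstoD(2)[OF to0]) simp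
    then obtain N where N: "2 * q / 2 ^ N < e / 2" by (auto simp: eventually_sequentially)
    have "dist (x m) (x n) < e" if "N \<le> m" "N \<le> n" for m n
      using dist_triangle3[of "x m" "x n" "x N"] bound[OF that(1)] bound[OF that(2)] N by linarith
    then show "\<exists>M. \<forall>m\<ge>M. \<forall>n\<ge>M. dist (x m) (x n) < e" by blast
  qed
  then have "x \<longlonglongrightarrow> lim x" by (simp add: Cauchy_convergent_iff convergent_LIMSEQ_iff)
  then have "(\<lambda>m. dist (x N) (x m)) \<longlonglongrightarrow> dist (x N) (lim x)" by (intro tendsto_intros)
  then have "dist (x N) (lim x) \<le> 2 * q / 2 ^ N"
    by (rule LIMSEQ_le_const2) (use bound in blast)
  then have "(dist (x N) (lim x))\<^sup>2 \<le> (2 * q / 2 ^ N)\<^sup>2" by (intro power_mono) auto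
  also have "\<dots> = 4 * Z / 4 ^ N"
    using Z0 by (simp add: q_def power_divide power_mult_distrib power_mult[symmetric] mult.commute[of _ 2] power_mult)
  finally show ?thesis .
qed

lemma chain_realization:
  fixes \<mu> :: "nat \<Rightarrow> 'a::euclidean_space measure"
  assumes \<mu>: "\<And>n. \<mu> n \<in> Prob" and W: "\<And>n. W2sq (\<mu> n) (\<mu> (Suc n)) < ennreal (b n)"
  shows "\<exists>L. prob_space L \<and> sets L = sets (PiM UNIV (\<lambda>_::nat. borel)) \<and>
    (\<forall>n. distr L borel (\<lambda>\<omega>. \<omega> n) = \<mu> n) \<and>
    (\<forall>n. (\<integral>\<^sup>+ \<omega>. ennreal ((dist (\<omega> n) (\<omega> (Suc n)))\<^sup>2) \<partial>L) \<le> ennreal (10 * b n))"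
proof -
  have "\<exists>K. \<forall>n. K n \<in> borel \<rightarrow>\<^sub>M subprob_algebra borel \<and> (\<forall>x. prob_space (K n x)) \<and>
    (\<forall>F\<in>borel_measurable borel. (\<integral>\<^sup>+ x. (\<integral>\<^sup>+ y. F y \<partial>K n x) \<partial>\<mu> n) = (\<integral>\<^sup>+ y. F y \<partial>\<mu> (Suc n))) \<and>
    (\<integral>\<^sup>+ x. (\<integral>\<^sup>+ y. ennreal ((dist x y)\<^sup>2) \<partial>K n x) \<partial>\<mu> n) \<le> ennreal (10 * b n)"
    by (intro choice allI approximate_gluing_kernel W)
  then obtain K where K [measurable]: "\<And>n. K n \<in> borel \<rightarrow>\<^sub>M subprob_algebra borel"
    and prob_K: "\<And>n x. prob_space (K n x)"
    and law_K: "\<And>n F. F \<in> borel_measurable borel \<Longrightarrow> (\<integral>\<^sup>+ x. (\<integral>\<^sup>+ y. F y \<partial>K n x) \<partial>\<mu> n) = (\<integral>\<^sup>+ y. F y \<partial>\<mu> (Suc n))"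
    and cost_K: "\<And>n. (\<integral>\<^sup>+ x. (\<integral>\<^sup>+ y. ennreal ((dist x y)\<^sup>2) \<partial>K n x) \<partial>\<mu> n) \<le> ennreal (10 * b n)"
    by blast
  have \<mu>_prob: "prob_space (\<mu> n)" and \<mu>_sets: "sets (\<mu> n) = sets borel" for n using \<mu> by (auto simp: Prob_def)
  obtain L where L: "prob_space L" and sets_L [measurable_cong]: "sets L = sets (PiM UNIV (\<lambda>_::nat. borel :: 'a measure))"
    and law0: "distr L borel (\<lambda>\<omega>. \<omega> 0) = \<mu> 0"
    and step: "\<And>n g. case_prod g \<in> borel_measurable (borel \<Otimes>\<^sub>M borel) \<Longrightarrow>
      (\<integral>\<^sup>+ \<omega>. g (\<omega> n) (\<omega> (Suc n)) \<partial>L) = (\<integral>\<^sup>+ \<omega>. (\<integral>\<^sup>+ y. g (\<omega> n) y \<partial>K n (\<omega> n)) \<partial>L)"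
    using markov_process_exists[OF \<mu>_prob[of 0] \<mu>_sets[of 0], of K, OF K prob_K] by blast
  have X [measurable]: "(\<lambda>\<omega>. \<omega> n) \<in> borel_measurable L" for n by measurable
  have K_int [measurable]: "(\<lambda>x. \<integral>\<^sup>+ y. g x y \<partial>K n x) \<in> borel_measurable borel"
    if "case_prod g \<in> borel_measurable (borel \<Otimes>\<^sub>M borel)" for n g
    by (rule nn_integral_measurable_subprob_algebra2[OF that K])
  have law: "distr L borel (\<lambda>\<omega>. \<omega> n) = \<mu> n" for n
  proof (induction n)
    case (Suc n)
    show ?case
    proof (rule measure_eqI)
      fix A assume "A \<in> sets (distr L borel (\<lambda>\<omega>. \<omega> (Suc n)))"
      then have A [measurable]: "A \<in> sets borel" by simp
      have [measurable]: "(\<lambda>x. \<integral>\<^sup>+ y. indicator A y \<partial>K n x) \<in> borel_measurable borel"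
        by (rule K_int) measurable
      have "emeasure (distr L borel (\<lambda>\<omega>. \<omega> (Suc n))) A = (\<integral>\<^sup>+ \<omega>. indicator A (\<omega> (Suc n)) \<partial>L)"
        by (rule emeasure_distr_nn_integral) measurable
      also have "\<dots> = (\<integral>\<^sup>+ \<omega>. (\<integral>\<^sup>+ y. indicator A y \<partial>K n (\<omega> n)) \<partial>L)"
        by (rule step[where g = "\<lambda>_. indicator A"]) measurable
      also have "\<dots> = (\<integral>\<^sup>+ x. (\<integral>\<^sup>+ y. indicator A y \<partial>K n x) \<partial>\<mu> n)"
        unfolding Suc[symmetric]
        by (rule nn_integral_distr[symmetric]) (simp_all add: X)
      also have "\<dots> = (\<integral>\<^sup>+ y. indicator A y \<partial>\<mu> (Suc n))" by (rule law_K) simp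
      also have "\<dots> = emeasure (\<mu> (Suc n)) A" using A by (simp add: \<mu>_sets)
      finally show "emeasure (distr L borel (\<lambda>\<omega>. \<omega> (Suc n))) A = emeasure (\<mu> (Suc n)) A" .
    qed (simp add: \<mu>_sets)
  qed (rule law0)
  have cost: "(\<integral>\<^sup>+ \<omega>. ennreal ((dist (\<omega> n) (\<omega> (Suc n)))\<^sup>2) \<partial>L) \<le> ennreal (10 * b n)" for n
  proof -
    have m: "(\<lambda>(x, y). ennreal ((dist x y)\<^sup>2)) \<in> borel_measurable (borel \<Otimes>\<^sub>M (borel :: 'a measure))" by measurable
    have "(\<integral>\<^sup>+ \<omega>. ennreal ((dist (\<omega> n) (\<omega> (Suc n)))\<^sup>2) \<partial>L)
      = (\<integral>\<^sup>+ \<omega>. (\<integral>\<^sup>+ y. ennreal ((dist (\<omega> n) y)\<^sup>2) \<partial>K n (\<omega> n)) \<partial>L)"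
      by (rule step[OF m])
    also have "\<dots> = (\<integral>\<^sup>+ x. (\<integral>\<^sup>+ y. ennreal ((dist x y)\<^sup>2) \<partial>K n x) \<partial>\<mu> n)"
      unfolding law[symmetric] by (rule nn_integral_distr[symmetric, OF X]) (use K_int[OF m] in simp)
    finally show ?thesis using cost_K by simp
  qed
  show ?thesis using L sets_L law cost by blast
qed

text \<open>Finiteness must precede the real-valued triangle inequality, and a constant factor does
  no harm to it, so the approximate gluing is good enough.\<close>

lemma W2sq_finite_trans:
  fixes \<mu> \<nu> \<rho> :: "'a::euclidean_space measure"
  assumes P: "\<mu> \<in> Prob" "\<nu> \<in> Prob" "\<rho> \<in> Prob" and fin: "W2sq \<mu> \<nu> < \<infinity>" "W2sq \<nu> \<rho> < \<infinity>"
  shows "W2sq \<mu> \<rho> < \<infinity>"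
proof -
  obtain b1 b2 where b: "0 \<le> b1" "0 \<le> b2" "W2sq \<mu> \<nu> = ennreal b1" "W2sq \<nu> \<rho> = ennreal b2"
    using fin by (metis ennreal_cases infinity_ennreal_def less_irrefl)
  define B where "B = b1 + b2 + 1"
  \<comment> \<open>The three measures are continued by the constant \<open>\<rho>\<close> to an
    infinite chain; \<open>B\<close> is strictly above both costs, and above the zero cost of the
    constant tail.\<close>
  define m where "m n = (if n = 0 then \<mu> else if n = 1 then \<nu> else \<rho>)" for n :: nat
  have "m n \<in> Prob" for n using P by (simp add: m_def)
  moreover have "W2sq (m n) (m (Suc n)) < ennreal B" for n
  proof -
    have "b1 < B" "b2 < B" "0 < B" using b by (auto simp: B_def)
    then have "ennreal b1 < ennreal B" "ennreal b2 < ennreal B" "0 < ennreal B"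
      using b by (simp_all add: ennreal_less_iff)
    then show ?thesis using b W2sq_self[OF P(3)] by (simp add: m_def)
  qed
  ultimately obtain L where L: "prob_space L" and sets_L [measurable_cong]: "sets L = sets (PiM UNIV (\<lambda>_::nat. borel :: 'a measure))"
    and law: "\<And>n. distr L borel (\<lambda>\<omega>. \<omega> n) = m n"
    and cost: "\<And>n. (\<integral>\<^sup>+ \<omega>. ennreal ((dist (\<omega> n) (\<omega> (Suc n)))\<^sup>2) \<partial>L) \<le> ennreal (10 * B)"
    using chain_realization[of m "\<lambda>_. B"] by blast
  have X [measurable]: "(\<lambda>\<omega>. \<omega> n) \<in> borel_measurable L" for n by measurable
  have "W2sq \<mu> \<rho> \<le> (\<integral>\<^sup>+ \<omega>. ennreal ((dist (\<omega> 0) (\<omega> 2))\<^sup>2) \<partial>L)"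
    using W2sq_le_random_variables[OF L X X, of 0 2] by (simp add: law m_def)
  also have "\<dots> \<le> (\<integral>\<^sup>+ \<omega>. 2 * ennreal ((dist (\<omega> 0) (\<omega> (Suc 0)))\<^sup>2)
      + 2 * ennreal ((dist (\<omega> (Suc 0)) (\<omega> (Suc (Suc 0))))\<^sup>2) \<partial>L)"
  proof (rule nn_integral_mono)
    fix \<omega> :: "nat \<Rightarrow> 'a"
    have "(dist (\<omega> 0) (\<omega> 2))\<^sup>2 \<le> 2 * (dist (\<omega> 0) (\<omega> (Suc 0)))\<^sup>2 + 2 * (dist (\<omega> (Suc 0)) (\<omega> (Suc (Suc 0))))\<^sup>2"
      using dist_square_young[of 1 "\<omega> 0" "\<omega> 2" "\<omega> 1"] by (simp add: dist_commute numeral_2_eq_2)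
    then have "ennreal ((dist (\<omega> 0) (\<omega> 2))\<^sup>2)
      \<le> ennreal (2 * (dist (\<omega> 0) (\<omega> (Suc 0)))\<^sup>2 + 2 * (dist (\<omega> (Suc 0)) (\<omega> (Suc (Suc 0))))\<^sup>2)"
      by (rule ennreal_leI)
    then show "ennreal ((dist (\<omega> 0) (\<omega> 2))\<^sup>2) \<le> 2 * ennreal ((dist (\<omega> 0) (\<omega> (Suc 0)))\<^sup>2)
      + 2 * ennreal ((dist (\<omega> (Suc 0)) (\<omega> (Suc (Suc 0))))\<^sup>2)"
      by (simp add: ennreal_mult)
  qed
  also have "\<dots> = 2 * (\<integral>\<^sup>+ \<omega>. ennreal ((dist (\<omega> 0) (\<omega> (Suc 0)))\<^sup>2) \<partial>L)
      + 2 * (\<integral>\<^sup>+ \<omega>. ennreal ((dist (\<omega> (Suc 0)) (\<omega> (Suc (Suc 0))))\<^sup>2) \<partial>L)"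
    by (simp add: nn_integral_add nn_integral_cmult)
  also have "\<dots> \<le> 2 * ennreal (10 * B) + 2 * ennreal (10 * B)"
    by (intro add_mono mult_left_mono cost) auto
  also have "\<dots> < \<infinity>" by (simp add: ennreal_mult_less_top)
  finally show ?thesis .
qed

text \<open>On a common probability space the random sequence itself converges almost surely, and
  \<open>\<nu>\<close> is the law of its limit. The decay \<open>16 ^ n\<close> leaves room for the
  weight \<open>4 ^ n\<close>, which makes the pathwise steps summable.\<close>

lemma W2sq_fast_Cauchy_limit:
  fixes \<mu> :: "nat \<Rightarrow> 'a::euclidean_space measure"
  assumes \<mu>: "\<And>n. \<mu> n \<in> Prob" and W: "\<And>n. W2sq (\<mu> n) (\<mu> (Suc n)) < ennreal (B / 16 ^ n)"
  shows "\<exists>\<nu>\<in>Prob. \<forall>n. W2sq (\<mu> n) \<nu> \<le> ennreal (80 * B / 4 ^ n)"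
proof -
  obtain L where L: "prob_space L" and sets_L [measurable_cong]: "sets L = sets (PiM UNIV (\<lambda>_::nat. borel :: 'a measure))"
    and law: "\<And>n. distr L borel (\<lambda>\<omega>. \<omega> n) = \<mu> n"
    and cost: "\<And>n. (\<integral>\<^sup>+ \<omega>. ennreal ((dist (\<omega> n) (\<omega> (Suc n)))\<^sup>2) \<partial>L) \<le> ennreal (10 * (B / 16 ^ n))"
    using chain_realization[of \<mu> "\<lambda>n. B / 16 ^ n", OF \<mu> W] by blast
  have X [measurable]: "(\<lambda>\<omega>. \<omega> n) \<in> borel_measurable L" for n by measurable
  have B: "0 < B" using W[of 0] by (metis div_by_1 ennreal_neg not_less not_less_zero power_0)
  \<comment> \<open>Its expectation is at most \<open>10 * B * 4 / 3\<close>, rounded up to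
    \<open>20 * B\<close>; the factor 4 of the pathwise estimate then gives 80.\<close>
  define Z where "Z \<omega> = (\<Sum>n. ennreal (4 ^ n * (dist (\<omega> n) (\<omega> (Suc n)))\<^sup>2))" for \<omega> :: "nat \<Rightarrow> 'a"
  have [measurable]: "Z \<in> borel_measurable L" unfolding Z_def by measurable
  have "(\<integral>\<^sup>+ \<omega>. Z \<omega> \<partial>L) = (\<Sum>n. \<integral>\<^sup>+ \<omega>. ennreal (4 ^ n * (dist (\<omega> n) (\<omega> (Suc n)))\<^sup>2) \<partial>L)"
    unfolding Z_def by (rule nn_integral_suminf) measurable
  also have "\<dots> \<le> (\<Sum>n. ennreal (10 * B * (1 / 4) ^ n))"
  proof (rule suminf_le)
    fix n
    have "(\<integral>\<^sup>+ \<omega>. ennreal (4 ^ n * (dist (\<omega> n) (\<omega> (Suc n)))\<^sup>2) \<partial>L)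
      = ennreal (4 ^ n) * (\<integral>\<^sup>+ \<omega>. ennreal ((dist (\<omega> n) (\<omega> (Suc n)))\<^sup>2) \<partial>L)"
      by (simp add: ennreal_mult nn_integral_cmult)
    also have "\<dots> \<le> ennreal (4 ^ n) * ennreal (10 * (B / 16 ^ n))" by (intro mult_left_mono cost) simp
    also have "\<dots> = ennreal (10 * B * (1 / 4) ^ n)"
    proof -
      have "(16::real) ^ n = 4 ^ n * 4 ^ n" by (simp add: power_mult_distrib[symmetric])
      then show ?thesis using B by (simp add: ennreal_mult[symmetric] power_one_over field_simps)
    qed
    finally show "(\<integral>\<^sup>+ \<omega>. ennreal (4 ^ n * (dist (\<omega> n) (\<omega> (Suc n)))\<^sup>2) \<partial>L) \<le> ennreal (10 * B * (1 / 4) ^ n)" .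
  qed auto
  also have "\<dots> = ennreal (10 * B * (1 / (1 - 1 / 4)))"
    using B by (intro suminf_ennreal_eq sums_mult geometric_sums) auto
  also have "\<dots> \<le> ennreal (20 * B)" using B by (intro ennreal_leI) simp
  finally have Z: "(\<integral>\<^sup>+ \<omega>. Z \<omega> \<partial>L) \<le> ennreal (20 * B)" .
  \<comment> \<open>Where \<open>Z\<close> is infinite the bound is trivial, so the value of
    \<open>lim\<close> on divergent sequences does no harm.\<close>
  have pointwise: "ennreal ((dist (\<omega> n) (lim \<omega>))\<^sup>2) \<le> ennreal (4 / 4 ^ n) * Z \<omega>" for \<omega> n
  proof (cases "Z \<omega>")
    case (real z)
    have "ennreal (4 ^ k * (dist (\<omega> k) (\<omega> (Suc k)))\<^sup>2) \<le> ennreal z" for k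
    proof -
      have "(\<Sum>n\<in>{k}. ennreal (4 ^ n * (dist (\<omega> n) (\<omega> (Suc n)))\<^sup>2)) \<le> Z \<omega>"
        unfolding Z_def by (rule sum_le_suminf) auto
      then show ?thesis using real by simp
    qed
    then have "4 ^ k * (dist (\<omega> k) (\<omega> (Suc k)))\<^sup>2 \<le> z" for k using real by (simp add: ennreal_le_iff)
    then have "(dist (\<omega> n) (lim \<omega>))\<^sup>2 \<le> 4 * z / 4 ^ n" by (rule dist_lim_le_if_weighted_squares_le)
    then show ?thesis using real by (simp add: ennreal_mult[symmetric] ennreal_leI)
  next
    case top
    then show ?thesis by (simp add: ennreal_mult_top)
  qed
  have X_lim [measurable]: "(\<lambda>\<omega>. lim (\<lambda>n. \<omega> n)) \<in> borel_measurable L" by measurable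
  define \<nu> where "\<nu> = distr L borel (\<lambda>\<omega>. lim \<omega>)"
  have "\<nu> \<in> Prob" using prob_space.prob_space_distr[OF L X_lim] by (simp add: \<nu>_def Prob_def)
  moreover have "W2sq (\<mu> n) \<nu> \<le> ennreal (80 * B / 4 ^ n)" for n
  proof -
    have "W2sq (\<mu> n) \<nu> \<le> (\<integral>\<^sup>+ \<omega>. ennreal ((dist (\<omega> n) (lim \<omega>))\<^sup>2) \<partial>L)"
      unfolding \<nu>_def law[symmetric, of n] by (rule W2sq_le_random_variables[OF L X X_lim])
    also have "\<dots> \<le> (\<integral>\<^sup>+ \<omega>. ennreal (4 / 4 ^ n) * Z \<omega> \<partial>L)" by (intro nn_integral_mono pointwise)
    also have "\<dots> = ennreal (4 / 4 ^ n) * (\<integral>\<^sup>+ \<omega>. Z \<omega> \<partial>L)" by (rule nn_integral_cmult) measurable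
    also have "\<dots> \<le> ennreal (4 / 4 ^ n) * ennreal (20 * B)" by (intro mult_left_mono Z) simp
    also have "\<dots> = ennreal (80 * B / 4 ^ n)" using B by (simp add: ennreal_mult[symmetric])
    finally show ?thesis .
  qed
  ultimately show ?thesis by blast
qed

section \<open>Functionals convex along generalized geodesics\<close>

locale plan_space =
  fixes \<omega>0 :: "'a::euclidean_space measure"
  assumes base_Prob: "\<omega>0 \<in> Prob"
    and plans_exist: "\<And>\<omega> \<mu> \<nu>. \<lbrakk>\<omega> \<in> P2 \<omega>0; \<mu> \<in> P2 \<omega>0; \<nu> \<in> P2 \<omega>0\<rbrakk> \<Longrightarrow> plans \<omega> \<mu> \<nu> \<noteq> {}"
begin

lemma P2_Prob: "\<mu> \<in> P2 \<omega>0 \<Longrightarrow> \<mu> \<in> Prob"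
  by (simp add: P2_def)

lemma W2sq_finite:
  assumes "\<mu> \<in> P2 \<omega>0" "\<nu> \<in> P2 \<omega>0"
  shows "W2sq \<mu> \<nu> < \<infinity>"
  using assms W2sq_finite_trans[of \<mu> \<omega>0 \<nu>] base_Prob W2sq_commute[of \<omega>0 \<nu>] by (simp add: P2_def)

lemma P2_if_W2sq_finite:
  assumes "\<mu> \<in> P2 \<omega>0" "\<nu> \<in> Prob" "W2sq \<mu> \<nu> < \<infinity>"
  shows "\<nu> \<in> P2 \<omega>0"
  using assms W2sq_finite_trans[of \<nu> \<mu> \<omega>0] base_Prob W2sq_commute[of \<mu> \<nu>] by (simp add: P2_def)

lemma W2sq_eq_W2:
  assumes "\<mu> \<in> P2 \<omega>0" "\<nu> \<in> P2 \<omega>0"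
  shows "W2sq \<mu> \<nu> = ennreal ((W2 \<mu> \<nu>)\<^sup>2)"
  using W2sq_finite[OF assms] by (simp add: W2_def ennreal_enn2real)

lemma plan_real:
  assumes P: "\<omega> \<in> P2 \<omega>0" "\<mu> \<in> P2 \<omega>0" "\<nu> \<in> P2 \<omega>0" and w: "w \<in> plans \<omega> \<mu> \<nu>"
  shows "\<exists>K\<ge>0. W2_plan_sq w = ennreal K \<and> (W2 \<mu> \<nu>)\<^sup>2 \<le> K \<and>
    (\<forall>t>0. K \<le> (1 + t) * (W2 \<omega> \<mu>)\<^sup>2 + (1 + 1 / t) * (W2 \<omega> \<nu>)\<^sup>2)"
proof -
  interpret plan w \<omega> \<mu> \<nu> by (rule plan.intro[OF w])
  have le: "W2_plan_sq w \<le> ennreal ((1 + t) * (W2 \<omega> \<mu>)\<^sup>2 + (1 + 1 / t) * (W2 \<omega> \<nu>)\<^sup>2)" if "0 < t" for t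
    using W2_plan_sq_le[OF that] that by (simp add: W2sq_eq_W2 P ennreal_mult)
  obtain K where K: "0 \<le> K" "W2_plan_sq w = ennreal K"
    using le[of 1] by (cases "W2_plan_sq w") (auto simp: top_unique)
  show ?thesis
  proof (intro exI[of _ K] conjI allI impI K)
    show "(W2 \<mu> \<nu>)\<^sup>2 \<le> K" using W2sq_le_plan K by (simp add: W2sq_eq_W2 P)
    show "K \<le> (1 + t) * (W2 \<omega> \<mu>)\<^sup>2 + (1 + 1 / t) * (W2 \<omega> \<nu>)\<^sup>2" if t: "0 < t" for t
    proof -
      have "0 \<le> (1 + t) * (W2 \<omega> \<mu>)\<^sup>2 + (1 + 1 / t) * (W2 \<omega> \<nu>)\<^sup>2" using t by simp
      then show ?thesis using le[OF t] K by (simp only: ennreal_le_iff)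
    qed
  qed
qed

text \<open>A plan based at the intermediate measure already joins its optimal couplings with the
  two others; minimizing Young's bound over \<open>t\<close> gives the square of the sum.\<close>

lemma W2_triangle:
  assumes P: "\<mu> \<in> P2 \<omega>0" "\<omega> \<in> P2 \<omega>0" "\<nu> \<in> P2 \<omega>0"
  shows "W2 \<mu> \<nu> \<le> W2 \<mu> \<omega> + W2 \<omega> \<nu>"
proof -
  obtain w where w: "w \<in> plans \<omega> \<mu> \<nu>" using plans_exist P by blast
  obtain K where K: "(W2 \<mu> \<nu>)\<^sup>2 \<le> K"
    "\<And>t. 0 < t \<Longrightarrow> K \<le> (1 + t) * (W2 \<omega> \<mu>)\<^sup>2 + (1 + 1 / t) * (W2 \<omega> \<nu>)\<^sup>2"
    using plan_real[OF P(2,1,3) w] by blast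
  have "K \<le> (W2 \<omega> \<mu> + W2 \<omega> \<nu>)\<^sup>2"
    by (rule le_square_sum_if_young[OF W2_nonneg W2_nonneg K(2)])
  then have "(W2 \<mu> \<nu>)\<^sup>2 \<le> (W2 \<omega> \<mu> + W2 \<omega> \<nu>)\<^sup>2" using K(1) by linarith
  then show ?thesis
    unfolding W2_commute[of \<mu> \<omega>] by (rule power2_le_imp_le) (simp add: W2_nonneg)
qed

lemma W2_eq_0_iff:
  assumes "\<mu> \<in> P2 \<omega>0" "\<nu> \<in> P2 \<omega>0"
  shows "W2 \<mu> \<nu> = 0 \<longleftrightarrow> \<mu> = \<nu>"
proof
  assume "W2 \<mu> \<nu> = 0"
  then have 0: "W2sq \<mu> \<nu> = 0" using assms by (simp add: W2sq_eq_W2)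
  \<comment> \<open>The second target merely repeats \<open>\<nu>\<close>: a projection of the plan
    is an optimal coupling, so the cost 0 is attained.\<close>
  obtain w where "w \<in> plans \<mu> \<nu> \<nu>" using plans_exist assms by blast
  then obtain \<gamma> where "\<gamma> \<in> opt_couplings \<mu> \<nu>" by (auto simp: plans_def)
  then show "\<mu> = \<nu>" using 0 coupling_cost_0_imp_eq by (auto simp: opt_couplings_def)
next
  assume "\<mu> = \<nu>"
  then show "W2 \<mu> \<nu> = 0" using assms W2sq_self[OF P2_Prob] by (simp add: W2_def)
qed

sublocale W2: Metric_space "P2 \<omega>0" W2
  by unfold_locales (auto simp: W2_nonneg W2_commute W2_eq_0_iff W2_triangle)

lemma mcomplete_W2: "W2.mcomplete"
  unfolding W2.mcomplete_def
proof (intro allI impI)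
  fix \<sigma> assume \<sigma>: "W2.MCauchy \<sigma>"
  then have \<sigma>P: "\<sigma> n \<in> P2 \<omega>0" for n by (auto simp: W2.MCauchy_def)
  have "\<exists>N. \<forall>n n'. N \<le> n \<longrightarrow> N \<le> n' \<longrightarrow> W2 (\<sigma> n) (\<sigma> n') < 1 / 4 ^ k" for k :: nat
    using \<sigma> by (simp add: W2.MCauchy_def)
  then obtain N where N: "\<And>k n n'. \<lbrakk>N k \<le> n; N k \<le> n'\<rbrakk> \<Longrightarrow> W2 (\<sigma> n) (\<sigma> n') < 1 / 4 ^ k"
    by metis
  \<comment> \<open>Partial sums of \<open>Suc (N k)\<close> are strictly increasing and dominate
    every \<open>N n\<close>. The distance threshold \<open>1 / 4 ^ k\<close> becomes the required
    \<open>1 / 16 ^ k\<close> after squaring.\<close>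
  define r where "r n = (\<Sum>k\<le>n. Suc (N k))" for n
  have r_Suc: "r (Suc n) = r n + Suc (N (Suc n))" for n by (simp add: r_def)
  then have r: "strict_mono r" by (intro strict_mono_Suc_iff[THEN iffD2]) simp
  have rN: "N n \<le> r n" for n using r_Suc by (cases n) (simp_all add: r_def)
  have "W2sq (\<sigma> (r n)) (\<sigma> (r (Suc n))) < ennreal (1 / 16 ^ n)" for n
  proof -
    have "W2 (\<sigma> (r n)) (\<sigma> (r (Suc n))) < 1 / 4 ^ n"
      using N[of n "r n" "r (Suc n)"] rN[of n] r_Suc[of n] by simp
    then have "(W2 (\<sigma> (r n)) (\<sigma> (r (Suc n))))\<^sup>2 < (1 / 4 ^ n)\<^sup>2"
      by (rule power_strict_mono) (auto simp: W2_nonneg)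
    also have "(1 / 4 ^ n)\<^sup>2 = (1 / 16 ^ n :: real)"
      by (simp add: power_divide power2_eq_square power_mult_distrib[symmetric])
    finally show ?thesis by (simp add: W2sq_eq_W2 \<sigma>P ennreal_less_iff)
  qed
  then obtain \<nu> where \<nu>: "\<nu> \<in> Prob" and le: "\<And>n. W2sq (\<sigma> (r n)) \<nu> \<le> ennreal (80 * 1 / 4 ^ n)"
    using W2sq_fast_Cauchy_limit[of "\<lambda>n. \<sigma> (r n)" 1] \<sigma>P P2_Prob by metis
  have \<nu>P: "\<nu> \<in> P2 \<omega>0"
    using le[of 0] by (intro P2_if_W2sq_finite[OF \<sigma>P[of "r 0"] \<nu>]) (auto simp: le_less_trans)
  have "(\<lambda>n. (W2 (\<sigma> (r n)) \<nu>)\<^sup>2) \<longlonglongrightarrow> 0"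
  proof (rule tendsto_sandwich[where f = "\<lambda>_. 0" and h = "\<lambda>n. 80 * (1 / 4) ^ n"])
    show "\<forall>\<^sub>F n in sequentially. (W2 (\<sigma> (r n)) \<nu>)\<^sup>2 \<le> 80 * (1 / 4) ^ n"
      using le by (intro always_eventually allI) (simp add: W2sq_eq_W2 \<sigma>P \<nu>P power_one_over)
    have "(\<lambda>n. 80 * (1 / 4) ^ n) \<longlonglongrightarrow> 80 * (0::real)" by (intro tendsto_intros LIMSEQ_power_zero) simp
    then show "(\<lambda>n. 80 * (1 / 4) ^ n) \<longlonglongrightarrow> (0::real)" by simp
  qed auto
  then have "(\<lambda>n. sqrt ((W2 (\<sigma> (r n)) \<nu>)\<^sup>2)) \<longlonglongrightarrow> sqrt 0" by (intro tendsto_intros)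
  then have "(\<lambda>n. W2 (\<sigma> (r n)) \<nu>) \<longlonglongrightarrow> 0" by (simp add: W2_nonneg)
  then have "limitin W2.mtopology (\<sigma> \<circ> r) \<nu> sequentially"
    using \<sigma>P \<nu>P by (simp add: W2.limitin_metric_dist_null)
  then show "\<exists>x. limitin W2.mtopology \<sigma> x sequentially"
    using W2.MCauchy_convergent_subsequence[OF \<sigma> r] by blast
qed

lemma gen_geod_real:
  assumes P: "\<omega> \<in> P2 \<omega>0" "\<mu> \<in> P2 \<omega>0" "\<nu> \<in> P2 \<omega>0" and w: "w \<in> plans \<omega> \<mu> \<nu>"
    and K: "W2_plan_sq w = ennreal K" "0 \<le> K" and t: "t \<in> {0..1}"
  shows "gen_geod w t \<in> P2 \<omega>0"
    and "(W2 \<omega> (gen_geod w t))\<^sup>2 \<le> (1 - t) * (W2 \<omega> \<mu>)\<^sup>2 + t * (W2 \<omega> \<nu>)\<^sup>2 - t * (1 - t) * K"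
proof -
  interpret plan w \<omega> \<mu> \<nu> by (rule plan.intro[OF w])
  have le: "W2sq \<omega> (gen_geod w t) + ennreal (t * (1 - t) * K)
    \<le> ennreal ((1 - t) * (W2 \<omega> \<mu>)\<^sup>2 + t * (W2 \<omega> \<nu>)\<^sup>2)"
    using W2sq_gen_geod[OF t] t K by (simp add: W2sq_eq_W2 P ennreal_mult)
  then have "W2sq \<omega> (gen_geod w t) \<le> ennreal ((1 - t) * (W2 \<omega> \<mu>)\<^sup>2 + t * (W2 \<omega> \<nu>)\<^sup>2)"
    by (rule order_trans[rotated]) simp
  then show P': "gen_geod w t \<in> P2 \<omega>0"
    by (intro P2_if_W2sq_finite[OF P(1) gen_geod_Prob]) (auto simp: le_less_trans)
  have "0 \<le> t * (1 - t) * K" "0 \<le> (1 - t) * (W2 \<omega> \<mu>)\<^sup>2 + t * (W2 \<omega> \<nu>)\<^sup>2" using t K by auto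
  then show "(W2 \<omega> (gen_geod w t))\<^sup>2 \<le> (1 - t) * (W2 \<omega> \<mu>)\<^sup>2 + t * (W2 \<omega> \<nu>)\<^sup>2 - t * (1 - t) * K"
    using le by (simp add: W2sq_eq_W2 P P' ennreal_plus[symmetric] del: ennreal_plus)
qed

end

section \<open>The energy as an instance of the metric theory\<close>

locale gen_geod_convex_functional =
  fixes \<omega>0 :: "'a::euclidean_space measure" and E :: "'a measure \<Rightarrow> ereal" and lam :: real
  assumes base_Prob': "\<omega>0 \<in> Prob"
    and not_MInf: "\<forall>\<nu>\<in>P2 \<omega>0. E \<nu> \<noteq> -\<infinity>"
    and proper: "proper \<omega>0 E" and coercive: "coercive \<omega>0 E" and lsc: "lsc_W2 \<omega>0 E"
    and convex: "convex_gen_geod \<omega>0 E lam"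
begin

definition dom_E :: "'a measure set" where
  "dom_E = {\<mu> \<in> P2 \<omega>0. E \<mu> < \<infinity>}"

definition Er :: "'a measure \<Rightarrow> real" where
  "Er \<mu> = real_of_ereal (E \<mu>)"

lemma E_eq_Er: "\<mu> \<in> dom_E \<Longrightarrow> E \<mu> = ereal (Er \<mu>)"
  using not_MInf by (cases "E \<mu>") (auto simp: dom_E_def Er_def)

sublocale plan_space \<omega>0
proof
  show "\<omega>0 \<in> Prob" by (rule base_Prob')
  show "plans \<omega> \<mu> \<nu> \<noteq> {}" if "\<omega> \<in> P2 \<omega>0" "\<mu> \<in> P2 \<omega>0" "\<nu> \<in> P2 \<omega>0" for \<omega> \<mu> \<nu>
    using convex that unfolding convex_gen_geod_def by blast
qed

lemma neg_part_bounds: "0 \<le> neg_part lam" "- lam \<le> neg_part lam"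
  by (auto simp: neg_part_def)

sublocale proximal_space "P2 \<omega>0" W2 dom_E Er "neg_part lam"
proof unfold_locales
  show "W2.mcomplete" by (rule mcomplete_W2)
  show "dom_E \<subseteq> P2 \<omega>0" by (auto simp: dom_E_def)
  show "dom_E \<noteq> {}" using proper by (auto simp: dom_E_def proper_def)
  show "0 \<le> neg_part lam" by (rule neg_part_bounds)
next
  fix s c x
  assume s: "\<And>n. s n \<in> dom_E" "\<And>n. Er (s n) \<le> c" and x: "x \<in> P2 \<omega>0" "(\<lambda>n. W2 (s n) x) \<longlonglongrightarrow> 0"
  have sP: "s n \<in> P2 \<omega>0" for n using s(1) by (simp add: dom_E_def)
  have "E x \<le> liminf (\<lambda>n. E (s n))" using lsc x sP by (auto simp: lsc_W2_def)
  also have "\<dots> \<le> liminf (\<lambda>n. ereal c)"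
    using s by (intro Liminf_mono always_eventually) (auto simp: E_eq_Er)
  also have "\<dots> = ereal c" by (simp add: Liminf_const)
  finally have "E x \<le> ereal c" .
  then have "x \<in> dom_E" using x by (auto simp: dom_E_def)
  then show "x \<in> dom_E \<and> Er x \<le> c" using \<open>E x \<le> ereal c\<close> by (simp add: E_eq_Er)
next
  obtain \<tau>0 u where "0 < \<tau>0" "u \<in> P2 \<omega>0"
    and INF: "(INF v\<in>P2 \<omega>0. ereal ((W2 u v)\<^sup>2 / (2 * \<tau>0)) + E v) > -\<infinity>"
    using coercive by (auto simp: coercive_def)
  obtain c where c: "ereal c < (INF v\<in>P2 \<omega>0. ereal ((W2 u v)\<^sup>2 / (2 * \<tau>0)) + E v)"
    using ereal_dense2[OF INF] by blast
  have "c \<le> (W2 u v)\<^sup>2 / (2 * \<tau>0) + Er v" if v: "v \<in> dom_E" for v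
  proof -
    have "(INF v\<in>P2 \<omega>0. ereal ((W2 u v)\<^sup>2 / (2 * \<tau>0)) + E v) \<le> ereal ((W2 u v)\<^sup>2 / (2 * \<tau>0)) + E v"
      using v by (intro INF_lower) (simp add: dom_E_def)
    then have "ereal c \<le> ereal ((W2 u v)\<^sup>2 / (2 * \<tau>0)) + E v" using c by simp
    then show ?thesis using v by (simp add: E_eq_Er)
  qed
  then show "\<exists>\<tau>0>0. \<exists>u\<in>P2 \<omega>0. \<exists>c. \<forall>v\<in>dom_E. c \<le> (W2 u v)\<^sup>2 / (2 * \<tau>0) + Er v"
    using \<open>0 < \<tau>0\<close> \<open>u \<in> P2 \<omega>0\<close> by blast
next
  fix \<omega> x y assume \<omega>: "\<omega> \<in> P2 \<omega>0" and x: "x \<in> dom_E" and y: "y \<in> dom_E"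
  then have P: "\<omega> \<in> P2 \<omega>0" "x \<in> P2 \<omega>0" "y \<in> P2 \<omega>0" by (auto simp: dom_E_def)
  obtain w where w: "w \<in> plans \<omega> x y" and cvx: "\<And>t. t \<in> {0..1} \<Longrightarrow>
      E (gen_geod w t) \<le> ereal (1 - t) * E x + ereal t * E y
            - ereal (t * (1 - t) * lam / 2) * enn2ereal (W2_plan_sq w)"
    using convex P unfolding convex_gen_geod_def by blast
  obtain K where K: "0 \<le> K" "W2_plan_sq w = ennreal K" "(W2 x y)\<^sup>2 \<le> K"
    using plan_real[OF P w] by blast
  have "gen_geod w t \<in> dom_E \<and> Er (gen_geod w t) \<le> (1 - t) * Er x + t * Er y + t * (1 - t) * neg_part lam / 2 * K
      \<and> (W2 \<omega> (gen_geod w t))\<^sup>2 \<le> (1 - t) * (W2 \<omega> x)\<^sup>2 + t * (W2 \<omega> y)\<^sup>2 - t * (1 - t) * K"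
    if t: "t \<in> {0..1}" for t
  proof -
    note g = gen_geod_real[OF P w K(2,1) t]
    have le: "E (gen_geod w t) \<le> ereal ((1 - t) * Er x + t * Er y - t * (1 - t) * lam / 2 * K)"
      using cvx[OF t] K by (simp add: E_eq_Er x y enn2ereal_ennreal)
    then have dom_E: "gen_geod w t \<in> dom_E" using g(1) by (auto simp: dom_E_def)
    \<comment> \<open>As the plan cost is nonnegative, so is \<open>q\<close>, and
      \<open>- lam\<close> may be replaced by the larger \<open>neg_part lam\<close>.\<close>
    define q where "q = t * (1 - t) * K / 2"
    have q: "t * (1 - t) * c / 2 * K = q * c" for c by (simp add: q_def)
    have "q * (- lam) \<le> q * neg_part lam"
      unfolding q_def using t K neg_part_bounds by (intro mult_left_mono) auto
    moreover have "Er (gen_geod w t) \<le> (1 - t) * Er x + t * Er y - t * (1 - t) * lam / 2 * K"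
      using le by (simp add: E_eq_Er dom_E)
    ultimately have "Er (gen_geod w t) \<le> (1 - t) * Er x + t * Er y + t * (1 - t) * neg_part lam / 2 * K"
      unfolding q by simp
    then show ?thesis using dom_E g(2) by blast
  qed
  then show "\<exists>g K. (W2 x y)\<^sup>2 \<le> K \<and>
      (\<forall>t\<in>{0..1}. g t \<in> dom_E
        \<and> Er (g t) \<le> (1 - t) * Er x + t * Er y + t * (1 - t) * neg_part lam / 2 * K
        \<and> (W2 \<omega> (g t))\<^sup>2 \<le> (1 - t) * (W2 \<omega> x)\<^sup>2 + t * (W2 \<omega> y)\<^sup>2 - t * (1 - t) * K)"
    using K(3) by blast
qed

text \<open>The minimization in \<open>JKO\<close> runs over all of \<open>P2\<close>, that in
  \<open>is_prox\<close> over the domain only. Competitors of infinite energy are harmless, and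
  properness keeps a minimizer inside the domain.\<close>

lemma is_prox_iff_ereal:
  "is_prox \<tau> \<mu> \<nu> \<longleftrightarrow> \<nu> \<in> P2 \<omega>0 \<and> (\<forall>\<nu>'\<in>P2 \<omega>0.
      ereal ((W2 \<mu> \<nu>)\<^sup>2 / (2 * \<tau>)) + E \<nu> \<le> ereal ((W2 \<mu> \<nu>')\<^sup>2 / (2 * \<tau>)) + E \<nu>')" (is "_ \<longleftrightarrow> ?Q")
proof
  assume p: "is_prox \<tau> \<mu> \<nu>"
  then have \<nu>: "\<nu> \<in> dom_E" by (simp add: is_prox_def)
  have "ereal ((W2 \<mu> \<nu>)\<^sup>2 / (2 * \<tau>)) + E \<nu> \<le> ereal ((W2 \<mu> \<nu>')\<^sup>2 / (2 * \<tau>)) + E \<nu>'" if "\<nu>' \<in> P2 \<omega>0" for \<nu>'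
  proof (cases "\<nu>' \<in> dom_E")
    case True
    then show ?thesis using p by (simp add: is_prox_def prox_obj_def E_eq_Er \<nu>)
  next
    case False
    then show ?thesis using that by (auto simp: dom_E_def)
  qed
  then show ?Q using \<nu> by (simp add: dom_E_def)
next
  assume Q: ?Q
  obtain p where p: "p \<in> dom_E" using D_nonempty by auto
  then have "ereal ((W2 \<mu> \<nu>)\<^sup>2 / (2 * \<tau>)) + E \<nu> \<le> ereal ((W2 \<mu> p)\<^sup>2 / (2 * \<tau>) + Er p)"
    using Q by (auto simp: dom_E_def E_eq_Er[OF p] dest!: bspec[of _ _ p])
  then have \<nu>: "\<nu> \<in> dom_E" using Q by (cases "E \<nu>") (auto simp: dom_E_def)
  have "prox_obj \<tau> \<mu> \<nu> \<le> prox_obj \<tau> \<mu> z" if z: "z \<in> dom_E" for z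
  proof -
    have "ereal ((W2 \<mu> \<nu>)\<^sup>2 / (2 * \<tau>)) + E \<nu> \<le> ereal ((W2 \<mu> z)\<^sup>2 / (2 * \<tau>)) + E z"
      using Q z by (simp add: dom_E_def)
    then show ?thesis using z \<nu> by (simp add: E_eq_Er prox_obj_def)
  qed
  then show "is_prox \<tau> \<mu> \<nu>" using \<nu> by (simp add: is_prox_def)
qed

lemma JKO_is_prox:
  assumes "0 < \<tau>" "neg_part lam * \<tau> < 1" "\<mu> \<in> P2 \<omega>0"
  shows "is_prox \<tau> \<mu> (JKO \<omega>0 E \<tau> \<mu>)"
proof -
  have "JKO \<omega>0 E \<tau> \<mu> = (THE \<nu>. is_prox \<tau> \<mu> \<nu>)"
    unfolding JKO_def is_prox_iff_ereal ..
  moreover have "\<exists>!\<nu>. is_prox \<tau> \<mu> \<nu>"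
    using prox_exists[OF assms] prox_unique[OF assms] by blast
  ultimately show ?thesis using theI'[of "is_prox \<tau> \<mu>"] by simp
qed

text \<open>The absolute value provides a nonnegative real bound even if the extended slope were
  \<open>-\<infinity>\<close>, the supremum over an empty set; it disappears when the slope is
  squared.\<close>

lemma slope_bound_slope:
  assumes "\<mu> \<in> dom_slope \<omega>0 E"
  shows "slope_bound \<mu> \<bar>real_of_ereal (slope \<omega>0 E \<mu>)\<bar>"
proof -
  define s where "s = \<bar>real_of_ereal (slope \<omega>0 E \<mu>)\<bar>"
  have \<mu>: "\<mu> \<in> dom_E" and fin: "slope \<omega>0 E \<mu> < \<infinity>" using assms by (auto simp: dom_slope_def dom_E_def)
  have s0: "0 \<le> s" unfolding s_def by (rule abs_ge_zero)
  have slope_le: "slope \<omega>0 E \<mu> \<le> ereal s" using fin by (cases "slope \<omega>0 E \<mu>") (auto simp: s_def)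
  \<comment> \<open>The infimum over radii need not be attained, so a suitable radius exists only
    for \<open>s + \<epsilon>\<close>; the global inequality obtained there survives the limit
    \<open>\<epsilon> \<rightarrow> 0\<close>.\<close>
  have sb: "slope_bound \<mu> (s + \<epsilon>)" if \<epsilon>: "0 < \<epsilon>" for \<epsilon>
  proof -
    have "slope \<omega>0 E \<mu> < ereal (s + \<epsilon>)" using slope_le \<epsilon> by (auto intro: le_less_trans)
    then obtain r where r: "0 < r" and SUP: "(SUP \<nu>\<in>{\<nu>\<in>P2 \<omega>0. 0 < W2 \<mu> \<nu> \<and> W2 \<mu> \<nu> < r}.
        max 0 (E \<mu> - E \<nu>) / ereal (W2 \<mu> \<nu>)) < ereal (s + \<epsilon>)"
      unfolding slope_def INF_less_iff by auto
    show ?thesis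
    proof (rule slope_bound_if_local[OF \<mu> _ r])
      show "0 \<le> s + \<epsilon>" using \<epsilon> s0 by simp
      fix y assume y: "y \<in> dom_E" "W2 \<mu> y < r"
      show "Er \<mu> - Er y \<le> (s + \<epsilon>) * W2 \<mu> y"
      proof (cases "W2 \<mu> y = 0")
        case True
        then have "\<mu> = y" using W2_eq_0_iff \<mu> y by (simp add: dom_E_def)
        then show ?thesis using True by simp
      next
        case False
        then have pos: "0 < W2 \<mu> y" using W2_nonneg[of \<mu> y] by linarith
        have "max 0 (E \<mu> - E y) / ereal (W2 \<mu> y) \<le> (SUP \<nu>\<in>{\<nu>\<in>P2 \<omega>0. 0 < W2 \<mu> \<nu> \<and> W2 \<mu> \<nu> < r}.
            max 0 (E \<mu> - E \<nu>) / ereal (W2 \<mu> \<nu>))"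
          using pos y by (intro SUP_upper) (simp add: dom_E_def)
        then have "max 0 (E \<mu> - E y) / ereal (W2 \<mu> y) \<le> ereal (s + \<epsilon>)" using SUP by simp
        then have "max 0 (Er \<mu> - Er y) / W2 \<mu> y \<le> s + \<epsilon>"
          using pos by (simp add: E_eq_Er \<mu> y zero_ereal_def ereal_max[symmetric] del: ereal_max)
        then have "max 0 (Er \<mu> - Er y) \<le> (s + \<epsilon>) * W2 \<mu> y" using pos by (simp add: pos_divide_le_eq)
        then show ?thesis by simp
      qed
    qed
  qed
  have "Er \<mu> \<le> Er y + s * W2 \<mu> y + neg_part lam / 2 * (W2 \<mu> y)\<^sup>2" if y: "y \<in> dom_E" for y
  proof (rule tendsto_lowerbound)
    show "((\<lambda>\<epsilon>. Er y + (s + \<epsilon>) * W2 \<mu> y + neg_part lam / 2 * (W2 \<mu> y)\<^sup>2)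
      \<longlongrightarrow> Er y + s * W2 \<mu> y + neg_part lam / 2 * (W2 \<mu> y)\<^sup>2) (at_right 0)"
      by (rule tendsto_eq_intros refl | simp)+
    show "\<forall>\<^sub>F \<epsilon> in at_right 0. Er \<mu> \<le> Er y + (s + \<epsilon>) * W2 \<mu> y + neg_part lam / 2 * (W2 \<mu> y)\<^sup>2"
      by (rule eventually_at_rightI[of 0 1]) (use sb y in \<open>auto simp: slope_bound_def\<close>)
  qed simp
  then show ?thesis using \<mu> s0 unfolding s_def[symmetric] by (simp add: slope_bound_def)
qed

end

theorem theoremA3:
  fixes \<omega>0 :: "'a::euclidean_space measure" and E :: "'a measure \<Rightarrow> ereal"
    and lam \<tau> :: real and h :: "nat \<Rightarrow> real" and \<mu> :: "'a measure" and n m :: nat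
  assumes "\<omega>0 \<in> Prob"
    and "\<forall>\<nu>\<in>P2 \<omega>0. E \<nu> \<noteq> -\<infinity>"
    and "proper \<omega>0 E" and "coercive \<omega>0 E" and "lsc_W2 \<omega>0 E"
    and "convex_gen_geod \<omega>0 E lam"
    and "\<mu> \<in> dom_slope \<omega>0 E"
    and "\<forall>i\<ge>1. 0 < h i \<and> h i \<le> \<tau>"
    and "neg_part lam * \<tau> < 1"
  shows "(W2 ((JKO \<omega>0 E \<tau> ^^ n) \<mu>) (JKO_var \<omega>0 E h \<mu> m))\<^sup>2
    \<le> ((real n * \<tau> - (\<Sum>k=1..m. h k))\<^sup>2 + \<tau> * (\<Sum>k=1..m. h k) + 2 * \<tau>\<^sup>2 * real n)
       * (1 - neg_part lam * \<tau>) powi (- 2 * int n)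
       * (\<Prod>k=1..m. 1 / (1 - neg_part lam * h k))\<^sup>2
       * (real_of_ereal (slope \<omega>0 E \<mu>))\<^sup>2"
proof -
  interpret gen_geod_convex_functional \<omega>0 E lam
    using assms(1-6) by unfold_locales
  have h: "0 < h (Suc k)" "h (Suc k) \<le> \<tau>" for k using assms(8) by auto
  have \<tau>: "0 < \<tau>" using h[of 0] by linarith
  have h1: "neg_part lam * h (Suc k) < 1" for k
    using mult_left_mono[OF h(2)[of k] neg_part_bounds(1)] assms(9) by linarith
  have \<mu>: "\<mu> \<in> P2 \<omega>0" using assms(7) by (simp add: dom_slope_def)
  have prox_P2: "is_prox t x y \<Longrightarrow> y \<in> P2 \<omega>0" for t x y using D_subset by (auto simp: is_prox_def)
  define y where "y k = (JKO \<omega>0 E \<tau> ^^ k) \<mu>" for k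
  define z where "z = JKO_var \<omega>0 E h \<mu>"
  have yP: "y k \<in> P2 \<omega>0" for k
    by (induction k) (simp_all add: y_def \<mu> prox_P2[OF JKO_is_prox[OF \<tau> assms(9)]])
  have zP: "z k \<in> P2 \<omega>0" for k
    by (induction k) (simp_all add: z_def \<mu> prox_P2[OF JKO_is_prox[OF h(1) h1]])
  have y: "y 0 = \<mu>" "is_prox \<tau> (y k) (y (Suc k))" for k
    using JKO_is_prox[OF \<tau> assms(9) yP, of k] by (simp_all add: y_def)
  have z: "z 0 = \<mu>" "is_prox (h (Suc k)) (z k) (z (Suc k))" for k
    using JKO_is_prox[OF h(1) h1 zP, of k] by (simp_all add: z_def)
  define S where "S = (\<Sum>k=1..m. h k)"
  define P where "P = (\<Prod>k=1..m. 1 / (1 - neg_part lam * h k))"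
  define A where "A = (1 / (1 - neg_part lam * \<tau>)) ^ n"
  define s where "s = real_of_ereal (slope \<omega>0 E \<mu>)"
  \<comment> \<open>Here the sharp weights are relaxed to the claimed bracket:
    \<open>h k \<le> \<tau>\<close> bounds each square by \<open>\<tau> * h k\<close>, and
    \<open>n * \<tau>\<^sup>2\<close> is simply doubled below.\<close>
  have "(\<Sum>k=1..m. (h k)\<^sup>2) \<le> (\<Sum>k=1..m. \<tau> * h k)"
    using assms(8) by (intro sum_mono) (auto simp: power2_eq_square intro!: mult_right_mono)
  then have T: "(\<Sum>k=1..m. (h k)\<^sup>2) \<le> \<tau> * S" by (simp add: S_def sum_distrib_left)
  have "(W2 (y n) (z m))\<^sup>2 \<le> ((real n * \<tau> - S)\<^sup>2 + real n * \<tau>\<^sup>2 + (\<Sum>k=1..m. (h k)\<^sup>2)) * A\<^sup>2 * P\<^sup>2 * s\<^sup>2"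
    using prox_orbit_estimate[OF slope_bound_slope[OF assms(7)] assms(9) h y z, of n m]
    unfolding S_def P_def A_def s_def power2_abs .
  also have "\<dots> \<le> ((real n * \<tau> - S)\<^sup>2 + \<tau> * S + 2 * \<tau>\<^sup>2 * real n) * A\<^sup>2 * P\<^sup>2 * s\<^sup>2"
  proof (intro mult_right_mono)
    have "real n * \<tau>\<^sup>2 \<le> 2 * \<tau>\<^sup>2 * real n" by simp
    then show "(real n * \<tau> - S)\<^sup>2 + real n * \<tau>\<^sup>2 + (\<Sum>k=1..m. (h k)\<^sup>2)
      \<le> (real n * \<tau> - S)\<^sup>2 + \<tau> * S + 2 * \<tau>\<^sup>2 * real n" using T by linarith
  qed auto
  also have "A\<^sup>2 = (1 - neg_part lam * \<tau>) powi (- 2 * int n)"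
  proof -
    have "(1 - neg_part lam * \<tau>) powi (- int (2 * n)) = inverse ((1 - neg_part lam * \<tau>) ^ (2 * n))"
      by (simp only: power_int_minus power_int_of_nat)
    then show ?thesis
      by (simp add: A_def power_one_over inverse_eq_divide power_divide power_mult[symmetric] mult.commute)
  qed
  finally show ?thesis by (simp add: y_def z_def S_def P_def s_def)
qed

end
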